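(* Let $\lambda$ be a singular cardinal of uncountable cofinality and let $\chi\le\operatorname{cf}(\lambda)$ be a cardinal. For every coloring $c:[\lambda^+]^2\to\lambda$ there exists a coloring $c^+:[\lambda^+]^2\to\lambda^+$ such that for every cardinal $\mu\le\lambda$ and every partition $p:[\lambda^+]^2\to\mu$: (1) if $c$ witnesses $\mathrm{pr}_1(\lambda^+,\lambda^+,\lambda,\chi)_p$ then $c^+$ witnesses $\mathrm{pr}_1(\lambda^+,\lambda^+,\lambda^+,\chi)_p$; (2) if $c$ witnesses $\mathrm{pr}_1(\lambda^+,\lambda^+\circledast\lambda^+,\lambda,\chi)_p$ then $c^+$ witnesses $\mathrm{pr}_1(\lambda^+,\lambda^+\circledast\lambda^+,\lambda^+,\chi)_p$.
   Context: $[\kappa]^2$ denotes the set of pairs $(\alpha,\beta)$ with $\alpha<\beta<\kappa$; a partition is any function $p:[\kappa]^2\to\mu$. For an ordinal $\sigma$, $[\kappa]^\sigma$ is the set of subsets of $\kappa$ of order type $\sigma$; $a<b$ means every element of $a$ is below every element of $b$. Given $p:[\kappa]^2\to\mu$, a coloring $c:[\kappa]^2\to\theta$ witnesses $\mathrm{pr}_1(\kappa,\kappa,\theta,\chi)_p$ iff for every ordinal $\sigma<\chi$, every pairwise disjoint $\mathcal A\subseteq[\kappa]^\sigma$ of size $\kappa$ and every $\tau:\mu\to\theta$ there are $a,b\in\mathcal A$, $a<b$, with $c(\alpha,\beta)=\tau(p(\alpha,\beta))$ for all $\alpha\in a,\beta\in b$. It witnesses $\mathrm{pr}_1(\kappa,\kappa\circledast\kappa,\theta,\chi)_p$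 iff for every ordinal $\sigma<\chi$ and every two families $\mathcal A,\mathcal B\subseteq[\kappa]^\sigma$, each pairwise disjoint and of size $\kappa$, there is $\mathcal A'\subseteq\mathcal A$ of size $\kappa$ such that for every $\tau:\mu\to\theta$ there are $a\in\mathcal A'$, $b\in\mathcal B$, $a<b$, with $c(\alpha,\beta)=\tau(p(\alpha,\beta))$ for all $\alpha\in a,\beta\in b$. *)

theory Defs
  imports Main
begin

unbundle cardinal_syntax

text \<open>Ordinals below a cardinal are modelled as elements of the field of a
cardinal-order (well-order) relation.  For a well-order K, the pair (x,y)
belongs to [Field K]^2 iff (x,y) is in K and x is different from y.\<close>

definition olt :: "'x rel \<Rightarrow> 'x \<Rightarrow> 'x \<Rightarrow> bool" where
  "olt K x y \<longleftrightarrow> (x, y) \<in> K \<and> x \<noteq> y"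

definition set_lt :: "'x rel \<Rightarrow> 'x set \<Rightarrow> 'x set \<Rightarrow> bool" where
  "set_lt K a b \<longleftrightarrow> (\<forall>\<alpha>\<in>a. \<forall>\<beta>\<in>b. olt K \<alpha> \<beta>)"

definition good_family :: "'x rel \<Rightarrow> 'c rel \<Rightarrow> 'x set set \<Rightarrow> bool" where
  "good_family K \<sigma> A \<longleftrightarrow>
     (\<forall>a\<in>A. a \<subseteq> Field K \<and> Restr K a =o \<sigma>) \<and>
     pairwise disjnt A \<and> |A| =o K"

text \<open>c witnesses pr_1(kappa, kappa, theta, chi)_p, where kappa = Field K
(ordered by K), theta is the colour set Th, chi is the cardinal chi and p is
a partition with colour set M (mu).\<close>
definition pr1 ::
  "'x rel \<Rightarrow> 't set \<Rightarrow> 'c rel \<Rightarrow> 'm set \<Rightarrow> ('x \<Rightarrow> 'x \<Rightarrow> 'm) \<Rightarrow> ('x \<Rightarrow> 'x \<Rightarrow> 't) \<Rightarrow> bool" where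
  "pr1 K Th chi M p c \<longleftrightarrow>
     (\<forall>\<sigma> :: 'c rel. Well_order \<sigma> \<and> \<sigma> <o chi \<longrightarrow>
       (\<forall>A. good_family K \<sigma> A \<longrightarrow>
         (\<forall>\<tau> :: 'm \<Rightarrow> 't. \<tau> ` M \<subseteq> Th \<longrightarrow>
           (\<exists>a\<in>A. \<exists>b\<in>A. set_lt K a b \<and>
              (\<forall>\<alpha>\<in>a. \<forall>\<beta>\<in>b. c \<alpha> \<beta> = \<tau> (p \<alpha> \<beta>))))))"

definition pr1_circ ::
  "'x rel \<Rightarrow> 't set \<Rightarrow> 'c rel \<Rightarrow> 'm set \<Rightarrow> ('x \<Rightarrow> 'x \<Rightarrow> 'm) \<Rightarrow> ('x \<Rightarrow> 'x \<Rightarrow> 't) \<Rightarrow> bool" where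
  "pr1_circ K Th chi M p c \<longleftrightarrow>
     (\<forall>\<sigma> :: 'c rel. Well_order \<sigma> \<and> \<sigma> <o chi \<longrightarrow>
       (\<forall>A B. good_family K \<sigma> A \<and> good_family K \<sigma> B \<longrightarrow>
         (\<exists>A' \<subseteq> A. |A'| =o K \<and>
           (\<forall>\<tau> :: 'm \<Rightarrow> 't. \<tau> ` M \<subseteq> Th \<longrightarrow>
             (\<exists>a\<in>A'. \<exists>b\<in>B. set_lt K a b \<and>
                (\<forall>\<alpha>\<in>a. \<forall>\<beta>\<in>b. c \<alpha> \<beta> = \<tau> (p \<alpha> \<beta>)))))))"

text \<open>The set of ordinals below a cardinal mu with mu \<le> lambda, where lambda
is represented by the cardinal order lam: either all of Field lam (mu = lambda)
or a proper initial segment of lam that is itself a cardinal.\<close>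
definition card_segment :: "'a rel \<Rightarrow> 'a set \<Rightarrow> bool" where
  "card_segment lam M \<longleftrightarrow>
     (M = Field lam \<or> (\<exists>m\<in>Field lam. M = underS lam m)) \<and> Card_order (Restr lam M)"

definition singular_uncountable_cf :: "'a rel \<Rightarrow> bool" where
  "singular_uncountable_cf lam \<longleftrightarrow>
     Card_order lam \<and> infinite (Field lam) \<and> \<not> regularCard lam \<and>
     (\<forall>A. A \<subseteq> Field lam \<and> cofinal A lam \<longrightarrow> natLeq <o card_of A)"

definition le_cf :: "'c rel \<Rightarrow> 'a rel \<Rightarrow> bool" where
  "le_cf chi lam \<longleftrightarrow> (\<forall>A. A \<subseteq> Field lam \<and> cofinal A lam \<longrightarrow> chi \<le>o card_of A)"

definition colouring :: "'x rel \<Rightarrow> 't set \<Rightarrow> ('x \<Rightarrow> 'x \<Rightarrow> 't) \<Rightarrow> bool" where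
  "colouring K Th c \<longleftrightarrow> (\<forall>\<alpha> \<beta>. \<alpha> \<in> Field K \<and> \<beta> \<in> Field K \<and> olt K \<alpha> \<beta> \<longrightarrow> c \<alpha> \<beta> \<in> Th)"

end

theory Submission
  imports Defs
begin

text \<open>Write \<lambda> for lam. A guessing argument yields, for \<eta> below the successor of \<lambda> and i < \<lambda>, a set
  trace(\<eta>, i) of size at most |i|, such that for every club D there is \<eta> for which unboundedly many
  trace(\<eta>, i) contain a point of D of cofinality greater than |i|. Let reach(\<beta>, i) be the union of
  the trace(\<eta>, i) over those \<eta> < \<beta> whose code below \<lambda> in a fixed enumeration of \<beta> is at most i.

  The value c(\<alpha>, \<beta>) is read as a triple (i, j, k). The first component gives the least element \<delta>
  of reach(\<beta>, i) above \<alpha>, then j is decoded to some \<gamma> < \<delta>, and k to an element of \<gamma>, which is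
  the new colour. Given \<tau>, choose \<gamma> bounding its range. By the hypothesis on c there is a club of \<delta>
  such that for every b above \<delta> and every \<rho> < \<delta>, each coded version of \<tau> is realised on a \<times> b by
  some a between \<rho> and \<delta>. Take \<eta> guessing this club and b above \<eta>. Since |b| < cf(\<lambda>), a single i
  puts trace(\<eta>, i) inside reach(\<beta>, i) for all \<beta> in b, and as cf(\<delta>) > |i| these sets are jointly
  bounded below \<delta> by some \<rho>. Hence \<delta> is recovered correctly from all \<alpha> in a and \<beta> in b.\<close>

lemma card_insert_le:
  assumes "infinite B" "|A| \<le>o |B|"
  shows "|insert x A| \<le>o |B|"
proof -
  have "|{x}| \<le>o |B|" using assms(1) by (metis card_of_singl_ordLeq finite.emptyI)
  then have "|{x} \<union> A| \<le>o |B|"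
    using assms by (intro card_of_Un_ordLeq_infinite_Field) (simp_all add: Field_card_of card_of_card_order_on card_of_mono1)
  then show ?thesis by simp
qed

lemma card_le_subset: "A \<subseteq> B \<Longrightarrow> |B| \<le>o r \<Longrightarrow> |A| \<le>o r"
  using card_of_mono1 ordLeq_transitive by blast

section \<open>The well-order of the successor cardinal\<close>

locale succ_of_card =
  fixes lam :: "'a rel"
  assumes card_lam: "Card_order lam" and inf_lam: "infinite (Field lam)"
begin

abbreviation K :: "'a set rel" where "K \<equiv> cardSuc lam"
abbreviation V :: "'a set set" where "V \<equiv> Field K"
abbreviation L :: "'a set" where "L \<equiv> Field lam"
abbreviation le (infix "\<sqsubseteq>" 50) where "x \<sqsubseteq> y \<equiv> (x, y) \<in> K"
abbreviation lt (infix "\<sqsubset>" 50) where "x \<sqsubset> y \<equiv> olt K x y"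

lemma card_K: "Card_order K"
  using card_lam cardSuc_Card_order by blast

lemma wo_K: "Well_order K"
  using card_K card_order_on_well_order_on by blast

lemma wo_lam: "Well_order lam"
  using card_lam card_order_on_well_order_on by blast

lemma inf_V: "infinite V"
  using card_lam inf_lam cardSuc_finite by blast

lemma le_refl: "x \<in> V \<Longrightarrow> x \<sqsubseteq> x"
  using wo_K by (simp add: order_on_defs well_order_on_def refl_on_def)

lemma le_trans: "x \<sqsubseteq> y \<Longrightarrow> y \<sqsubseteq> z \<Longrightarrow> x \<sqsubseteq> z"
  using wo_K by (simp add: order_on_defs well_order_on_def) (blast dest: transD)

lemma le_antisym: "x \<sqsubseteq> y \<Longrightarrow> y \<sqsubseteq> x \<Longrightarrow> x = y"
  using wo_K by (simp add: order_on_defs well_order_on_def) (blast dest: antisymD)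

lemma le_V: "x \<sqsubseteq> y \<Longrightarrow> x \<in> V" "x \<sqsubseteq> y \<Longrightarrow> y \<in> V"
  by (auto intro: FieldI1 FieldI2)

lemma lt_V: "x \<sqsubset> y \<Longrightarrow> x \<in> V" "x \<sqsubset> y \<Longrightarrow> y \<in> V"
  by (auto simp: olt_def intro: FieldI1 FieldI2)

lemma le_or_lt: "x \<in> V \<Longrightarrow> y \<in> V \<Longrightarrow> x \<sqsubseteq> y \<or> y \<sqsubset> x"
  using wo_K le_refl unfolding olt_def
  by (cases "x = y") (auto simp add: order_on_defs well_order_on_def total_on_def)

lemma lt_le: "x \<sqsubset> y \<Longrightarrow> x \<sqsubseteq> y"
  by (simp add: olt_def)

lemma lt_irrefl: "\<not> x \<sqsubset> x"
  by (simp add: olt_def)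

lemma le_lt_trans: "x \<sqsubseteq> y \<Longrightarrow> y \<sqsubset> z \<Longrightarrow> x \<sqsubset> z"
  unfolding olt_def using le_trans le_antisym by blast

lemma lt_le_trans: "x \<sqsubset> y \<Longrightarrow> y \<sqsubseteq> z \<Longrightarrow> x \<sqsubset> z"
  unfolding olt_def using le_trans le_antisym by blast

lemma not_lt_le: "x \<sqsubset> y \<Longrightarrow> y \<sqsubseteq> x \<Longrightarrow> False"
  unfolding olt_def using le_antisym by blast

lemma least_ex:
  assumes "x \<in> V" "P x"
  obtains m where "m \<in> V" "P m" "\<And>y. y \<in> V \<Longrightarrow> P y \<Longrightarrow> m \<sqsubseteq> y"
proof -
  interpret wo_rel K using wo_K by (simp add: wo_rel_def)
  let ?B = "{x \<in> V. P x}"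
  have B: "?B \<subseteq> V" "?B \<noteq> {}" using assms by auto
  show thesis
    using that[of "minim ?B"] minim_in[OF B] minim_least[OF B(1)] by blast
qed

lemma V_nomax: "x \<in> V \<Longrightarrow> \<exists>y. x \<sqsubset> y"
  using infinite_Card_order_limit[OF card_K inf_V, of x] by (auto simp: olt_def)

text \<open>This is regularity of the successor: a set of size at most \<open>lam\<close> cannot be
  cofinal in \<open>K\<close>. Non-cofinality only gives a weak bound \<open>a\<close>, and one step
  up to \<open>a'\<close> makes the bound strict.\<close>

lemma bounded_of_card_le:
  assumes "Y \<subseteq> V" "|Y| \<le>o lam"
  shows "\<exists>x\<in>V. \<forall>y\<in>Y. y \<sqsubset> x"
proof -
  have "regularCard K"
    using infinite_cardSuc_regularCard inf_lam card_lam by blast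
  moreover have "\<not> |Y| =o K"
    using assms(2) cardSuc_greater[OF card_lam] not_ordLess_ordIso ordLeq_ordLess_trans by blast
  ultimately have "\<not> cofinal Y K"
    using assms(1) unfolding regularCard_def by blast
  then obtain a where a: "a \<in> V" "\<forall>b\<in>Y. \<not> a \<sqsubset> b"
    unfolding cofinal_def olt_def by blast
  then obtain a' where "a \<sqsubset> a'" using V_nomax by blast
  with a assms(1) show ?thesis
    by (meson le_lt_trans le_or_lt lt_V(2) subsetD)
qed

lemma card_underS_le: "x \<in> V \<Longrightarrow> |underS K x| \<le>o lam"
  using card_of_underS[OF card_K, of x] cardSuc_ordLeq_ordLess[OF card_lam card_of_Card_order]
  by blast

lemma in_underS: "y \<in> underS K x \<longleftrightarrow> y \<sqsubset> x"
  by (auto simp: underS_def olt_def)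

lemma card_under_le: 
  assumes "x \<in> V" shows "|{y. y \<sqsubseteq> x}| \<le>o lam"
proof -
  obtain z where "x \<sqsubset> z" using V_nomax assms by blast
  then have "{y. y \<sqsubseteq> x} \<subseteq> underS K z" using in_underS le_lt_trans by blast
  then show ?thesis
    using card_of_mono1 card_underS_le[OF lt_V(2)[OF \<open>x \<sqsubset> z\<close>]] ordLeq_transitive by blast
qed

lemma card_L: "|L| =o lam" using card_lam card_of_Field_ordIso by blast

lemma unbounded_card:
  assumes "Z \<subseteq> V" "\<And>x. x \<in> V \<Longrightarrow> \<exists>z\<in>Z. x \<sqsubseteq> z"
  shows "|Z| =o K"
proof -
  have "\<not> |Z| \<le>o lam"
  proof
    assume "|Z| \<le>o lam"
    then obtain x where "x \<in> V" "\<forall>y\<in>Z. y \<sqsubset> x" using bounded_of_card_le assms(1) by blast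
    then show False using assms(2) not_lt_le by blast
  qed
  then have "lam <o |Z|" using card_lam card_of_Well_order wo_lam not_ordLeq_iff_ordLess by blast
  then have "K \<le>o |Z|" using cardSuc_least card_lam card_of_Card_order by blast
  moreover have "|Z| \<le>o K"
    using assms(1) card_of_mono1 card_K card_of_Field_ordIso ordLeq_ordIso_trans by blast
  ultimately show ?thesis using ordIso_iff_ordLeq by blast
qed

section \<open>Clubs of the successor cardinal, represented by functions\<close>

text \<open>Points closed under \<open>F\<close> stand in for a club. The weak inequality makes
  closure under suprema immediate and makes \<open>cl\<close> shrink as \<open>F\<close> grows
  pointwise. The least ordinal satisfies the condition vacuously, so \<open>cl F\<close> meets every
  initial segment \<open>{x. x \<sqsubseteq> y}\<close> with \<open>y \<in> V\<close>.\<close>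

definition cl :: "('a set \<Rightarrow> 'a set) \<Rightarrow> 'a set set" where
  "cl F = {\<delta> \<in> V. \<forall>\<rho>. \<rho> \<sqsubset> \<delta> \<longrightarrow> F \<rho> \<sqsubseteq> \<delta>}"

lemma cl_V: "x \<in> cl F \<Longrightarrow> x \<in> V" by (simp add: cl_def)

lemma cl_sup:
  assumes "s \<in> V" "\<And>\<rho>. \<rho> \<sqsubset> s \<Longrightarrow> \<exists>x\<in>cl F. \<rho> \<sqsubset> x \<and> x \<sqsubseteq> s"
  shows "s \<in> cl F"
  unfolding cl_def using assms by (auto simp: cl_def) (meson le_trans)

text \<open>The required point is the supremum \<open>s\<close> of the part of \<open>cl F\<close>
  up to \<open>y\<close>, which lies in \<open>cl F\<close> by closedness.\<close>

lemma retract_ex: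
  assumes "y \<in> V"
  shows "\<exists>x. x \<in> cl F \<and> x \<sqsubseteq> y \<and> (\<forall>z\<in>cl F. z \<sqsubseteq> y \<longrightarrow> z \<sqsubseteq> x)"
proof -
  obtain s where s: "s \<in> V" "\<forall>x\<in>cl F. x \<sqsubseteq> y \<longrightarrow> x \<sqsubseteq> s"
    "\<And>t. t \<in> V \<Longrightarrow> \<forall>x\<in>cl F. x \<sqsubseteq> y \<longrightarrow> x \<sqsubseteq> t \<Longrightarrow> s \<sqsubseteq> t"
    using least_ex[of y "\<lambda>s. \<forall>x\<in>cl F. x \<sqsubseteq> y \<longrightarrow> x \<sqsubseteq> s"] assms by blast
  have "s \<in> cl F"
  proof (rule cl_sup[OF s(1)])
    fix \<rho> assume "\<rho> \<sqsubset> s"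
    then obtain x where "x \<in> cl F" "x \<sqsubseteq> y" "\<not> x \<sqsubseteq> \<rho>"
      using s(3) lt_V(1) not_lt_le by blast
    then show "\<exists>x\<in>cl F. \<rho> \<sqsubset> x \<and> x \<sqsubseteq> s"
      using s(2) le_or_lt[of x \<rho>] lt_V(1)[OF \<open>\<rho> \<sqsubset> s\<close>] cl_V by blast
  qed
  then show ?thesis using s assms by blast
qed

definition retract :: "('a set \<Rightarrow> 'a set) \<Rightarrow> 'a set \<Rightarrow> 'a set" where
  "retract F y = (SOME x. x \<in> cl F \<and> x \<sqsubseteq> y \<and> (\<forall>z\<in>cl F. z \<sqsubseteq> y \<longrightarrow> z \<sqsubseteq> x))"

lemma retract:
  assumes "y \<in> V"
  shows "retract F y \<in> cl F" "retract F y \<sqsubseteq> y" "\<And>z. z \<in> cl F \<Longrightarrow> z \<sqsubseteq> y \<Longrightarrow> z \<sqsubseteq> retract F y"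
  using someI_ex[OF retract_ex[OF assms, of F]] unfolding retract_def[symmetric] by auto

text \<open>The usual closing-off argument: \<open>S x\<close> exceeds \<open>x\<close> and every
  \<open>F z\<close> with \<open>z \<sqsubseteq> x\<close>, and the supremum of the iterates of
  \<open>S\<close> from \<open>\<rho>\<close> is closed under \<open>F\<close>. That supremum exists
  because countable sets are bounded.\<close>

lemma cl_unbounded:
  assumes F: "\<And>x. x \<in> V \<Longrightarrow> F x \<in> V" and "\<rho> \<in> V"
  shows "\<exists>\<delta>\<in>cl F. \<rho> \<sqsubset> \<delta>"
proof -
  have "\<exists>y. x \<sqsubset> y \<and> (\<forall>z. z \<sqsubseteq> x \<longrightarrow> F z \<sqsubset> y)" if x: "x \<in> V" for x
  proof -
    have "|F ` {z. z \<sqsubseteq> x}| \<le>o lam"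
      using card_under_le[OF x] card_of_image ordLeq_transitive by blast
    then obtain u where u: "u \<in> V" "\<forall>y\<in>F ` {z. z \<sqsubseteq> x}. y \<sqsubset> u"
      using bounded_of_card_le[of "F ` {z. z \<sqsubseteq> x}"] F le_V by blast
    obtain v where v: "x \<sqsubset> v" using V_nomax x by blast
    show ?thesis using u v le_or_lt[of u v] lt_le_trans lt_le le_lt_trans lt_V
      by (metis (mono_tags, lifting) image_eqI mem_Collect_eq)
  qed
  then obtain S where S: "\<And>x. x \<in> V \<Longrightarrow> x \<sqsubset> S x \<and> (\<forall>z. z \<sqsubseteq> x \<longrightarrow> F z \<sqsubset> S x)" by metis
  define f where "f n = (S ^^ n) \<rho>" for n
  have fV: "f n \<in> V" for n
    by (induction n) (auto simp: f_def assms(2) dest: S intro: lt_V)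
  have "|range f| \<le>o lam"
    using card_of_image[of f UNIV] infinite_iff_card_of_nat inf_lam card_L 
    by (meson ordLeq_ordIso_trans ordLeq_transitive)
  then obtain u where "u \<in> V" "\<forall>n. f n \<sqsubseteq> u"
    using bounded_of_card_le[of "range f"] fV lt_le by blast
  then obtain s where s: "s \<in> V" "\<forall>n. f n \<sqsubseteq> s" "\<And>t. t \<in> V \<Longrightarrow> \<forall>n. f n \<sqsubseteq> t \<Longrightarrow> s \<sqsubseteq> t"
    using least_ex[of u "\<lambda>s. \<forall>n. f n \<sqsubseteq> s"] by blast
  have "F x \<sqsubseteq> s" if x: "x \<sqsubset> s" for x
  proof -
    obtain n where "\<not> f n \<sqsubseteq> x" using s(3) x lt_V(1) not_lt_le by blast
    then have "x \<sqsubseteq> f n" using le_or_lt fV lt_V(1)[OF x] lt_le by blast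
    then have "F x \<sqsubseteq> f (Suc n)" using S[OF fV[of n]] lt_le by (auto simp: f_def)
    then show ?thesis using s(2) le_trans by blast
  qed
  moreover have "\<rho> \<sqsubset> s"
    using S[OF \<open>\<rho> \<in> V\<close>] spec[OF s(2), of 1] lt_le_trans[of \<rho> "f 1" s] by (auto simp: f_def)
  ultimately show ?thesis using s(1) unfolding cl_def by blast
qed

section \<open>Points of large cofinality\<close>

text \<open>Field elements of lam double as size bounds: i stands for the cardinality of its initial
  segment, and bigcof i \<delta> says that cf(\<delta>) exceeds it. The instance Y = {} excludes \<delta> = 0.\<close>
definition bigcof :: "'a \<Rightarrow> 'a set \<Rightarrow> bool" where
  "bigcof i \<delta> \<longleftrightarrow> (\<forall>Y. Y \<subseteq> underS K \<delta> \<and> |Y| \<le>o |underS lam i| \<longrightarrow>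
     (\<exists>\<rho>. \<rho> \<sqsubset> \<delta> \<and> (\<forall>y\<in>Y. y \<sqsubseteq> \<rho>)))"

lemma card_underS_lam: "i \<in> L \<Longrightarrow> |underS lam i| <o lam"
  using card_of_underS[OF card_lam] by blast

text \<open>Let \<open>x\<close> be least such that \<open>cl F\<close> has more than
  \<open>|underS lam i|\<close> points below \<open>x\<close>. If a set \<open>Y\<close> of at most
  that size were unbounded in \<open>x\<close>, the parts of \<open>cl F\<close> up to the elements
  of \<open>Y\<close> would cover everything below \<open>x\<close>, and their union would be too
  small. The same count shows that \<open>cl F\<close> is unbounded in \<open>x\<close>, so
  \<open>x\<close> belongs to it.\<close>

lemma bigcof_in_cl:
  assumes F: "\<And>x. x \<in> V \<Longrightarrow> F x \<in> V" and i: "i \<in> L" "infinite (underS lam i)"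
  shows "\<exists>\<delta>\<in>cl F. bigcof i \<delta>"
proof -
  let ?k = "|underS lam i|"
  have Z: "|cl F| =o K"
    using unbounded_card[of "cl F"] cl_unbounded[of F] F cl_V lt_le by blast
  have "|L| \<le>o |cl F|" 
    using Z card_L cardSuc_greater[OF card_lam] 
    by (meson ordIso_ordLeq_trans ordIso_symmetric ordLeq_ordIso_trans ordLess_imp_ordLeq)
  \<comment> \<open>A copy of \<open>L\<close> inside \<open>cl F\<close> is bounded in
    \<open>K\<close>, and its bound \<open>u\<close> shows that some initial segment contains enough
    points of \<open>cl F\<close>.\<close>
  then obtain g where g: "inj_on g L" "g ` L \<subseteq> cl F"
    using card_of_ordLeq[of L "cl F"] by blast
  have "|g ` L| \<le>o lam" using card_of_image card_L ordLeq_ordIso_trans by blast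
  then obtain u where u: "u \<in> V" "\<forall>y\<in>g ` L. y \<sqsubset> u"
    using bounded_of_card_le[of "g ` L"] g(2) cl_V by blast
  have "|L| \<le>o |cl F \<inter> underS K u|"
    using g u(2) card_of_ordLeq[of L "cl F \<inter> underS K u"] in_underS by blast
  moreover have "?k <o |L|" using card_underS_lam[OF i(1)] card_L ordIso_symmetric ordLess_ordIso_trans by blast
  ultimately have "?k <o |cl F \<inter> underS K u|" using ordLess_ordLeq_trans by blast
  then obtain x where x: "x \<in> V" "?k <o |cl F \<inter> underS K x|"
    "\<And>y. y \<in> V \<Longrightarrow> ?k <o |cl F \<inter> underS K y| \<Longrightarrow> x \<sqsubseteq> y"
    using least_ex[of u "\<lambda>x. ?k <o |cl F \<inter> underS K x|"] u(1) by blast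
  have le: "|cl F \<inter> {z. z \<sqsubseteq> y}| \<le>o ?k" if "y \<sqsubset> x" for y
  proof -
    have "\<not> ?k <o |cl F \<inter> underS K y|" using x(3) that not_lt_le lt_V by blast
    then have "|cl F \<inter> underS K y| \<le>o ?k"
      using ordLess_or_ordLeq[OF card_of_Well_order card_of_Well_order] by blast
    then have "|insert y (cl F \<inter> underS K y)| \<le>o ?k" by (rule card_insert_le[OF i(2)])
    moreover have "cl F \<inter> {z. z \<sqsubseteq> y} \<subseteq> insert y (cl F \<inter> underS K y)"
      by (auto simp: in_underS olt_def)
    ultimately show ?thesis using card_le_subset by blast
  qed
  have "bigcof i x"
    unfolding bigcof_def
  proof (intro allI impI, rule ccontr)
    fix Y assume Y: "Y \<subseteq> underS K x \<and> |Y| \<le>o ?k"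
      and no: "\<not> (\<exists>\<rho>. \<rho> \<sqsubset> x \<and> (\<forall>y\<in>Y. y \<sqsubseteq> \<rho>))"
    have "cl F \<inter> underS K x \<subseteq> (\<Union>y\<in>Y. cl F \<inter> {z. z \<sqsubseteq> y})"
    proof
      fix z assume z: "z \<in> cl F \<inter> underS K x"
      then obtain y where y: "y \<in> Y" "\<not> y \<sqsubseteq> z" using no in_underS by blast
      then have "z \<sqsubset> y" using le_or_lt[of y z] Y z in_underS lt_V by blast
      then show "z \<in> (\<Union>y\<in>Y. cl F \<inter> {z. z \<sqsubseteq> y})" using y z lt_le by blast
    qed
    moreover have "|\<Union>y\<in>Y. cl F \<inter> {z. z \<sqsubseteq> y}| \<le>o ?k"
    proof (rule card_of_UNION_ordLeq_infinite[OF i(2)])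
      show "|Y| \<le>o ?k" using Y by blast
      show "\<forall>y\<in>Y. |cl F \<inter> {z. z \<sqsubseteq> y}| \<le>o ?k" using le Y in_underS by fast
    qed
    ultimately have "|cl F \<inter> underS K x| \<le>o ?k" by (rule card_le_subset)
    then show False using x(2) not_ordLess_ordLeq by blast
  qed
  moreover have "x \<in> cl F"
  proof (rule cl_sup[OF x(1)])
    fix \<rho> assume \<rho>: "\<rho> \<sqsubset> x"
    have "\<not> cl F \<inter> underS K x \<subseteq> cl F \<inter> {z. z \<sqsubseteq> \<rho>}"
      using card_le_subset[OF _ le[OF \<rho>]] x(2) not_ordLess_ordLeq by blast
    then obtain z where "z \<in> cl F" "z \<sqsubset> x" "\<not> z \<sqsubseteq> \<rho>" using in_underS by blast
    then show "\<exists>z\<in>cl F. \<rho> \<sqsubset> z \<and> z \<sqsubseteq> x" using le_or_lt[of z \<rho>] cl_V lt_le lt_V(1)[OF \<rho>] by blast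
  qed
  ultimately show ?thesis by blast
qed

section \<open>Ladders and the descent into a club\<close>

text \<open>A small set witnessing that \<open>bigcof i \<delta>\<close> fails. It is empty where
  \<open>bigcof\<close> holds, so descents stop there. Successors are among those points, since the
  weak bound \<open>\<rho>\<close> in \<open>bigcof\<close> may be the predecessor.\<close>

definition ladder :: "'a \<Rightarrow> 'a set \<Rightarrow> 'a set set" where
  "ladder i \<delta> = (if bigcof i \<delta> then {} else SOME Y. Y \<subseteq> underS K \<delta> \<and> |Y| \<le>o |underS lam i| \<and>
     \<not> (\<exists>\<rho>. \<rho> \<sqsubset> \<delta> \<and> (\<forall>y\<in>Y. y \<sqsubseteq> \<rho>)))"

lemma ladder_not_bigcof:
  assumes "\<not> bigcof i \<delta>"
  shows "ladder i \<delta> \<subseteq> underS K \<delta>" "|ladder i \<delta>| \<le>o |underS lam i|"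
    "\<And>\<rho>. \<rho> \<sqsubset> \<delta> \<Longrightarrow> \<exists>y\<in>ladder i \<delta>. \<not> y \<sqsubseteq> \<rho>"
proof -
  have "\<exists>Y. Y \<subseteq> underS K \<delta> \<and> |Y| \<le>o |underS lam i| \<and> \<not> (\<exists>\<rho>. \<rho> \<sqsubset> \<delta> \<and> (\<forall>y\<in>Y. y \<sqsubseteq> \<rho>))"
    using assms unfolding bigcof_def by blast
  from someI_ex[OF this] show "ladder i \<delta> \<subseteq> underS K \<delta>" "|ladder i \<delta>| \<le>o |underS lam i|"
    "\<And>\<rho>. \<rho> \<sqsubset> \<delta> \<Longrightarrow> \<exists>y\<in>ladder i \<delta>. \<not> y \<sqsubseteq> \<rho>"
    using assms unfolding ladder_def by auto
qed

lemma ladder: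
  "ladder i \<delta> \<subseteq> underS K \<delta>" "|ladder i \<delta>| \<le>o |underS lam i|"
proof -
  show "ladder i \<delta> \<subseteq> underS K \<delta>"
    by (cases "bigcof i \<delta>") (simp_all add: ladder_not_bigcof(1), simp add: ladder_def)
  show "|ladder i \<delta>| \<le>o |underS lam i|"
    by (cases "bigcof i \<delta>") (simp_all add: ladder_not_bigcof(2), simp add: ladder_def card_of_empty)
qed

text \<open>The levels of a descent tree: from each point one moves to every rung of its ladder and
  then down into \<open>cl F\<close>. All sets visited thus stay inside \<open>cl F\<close>, while
  the number of branches at a point is controlled by \<open>i\<close>.\<close>

primrec level :: "('a set \<Rightarrow> 'a set) \<Rightarrow> 'a set \<Rightarrow> 'a \<Rightarrow> nat \<Rightarrow> 'a set set" where
  "level F \<eta> i 0 = {retract F \<eta>}"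
| "level F \<eta> i (Suc n) = (\<Union>x\<in>level F \<eta> i n. retract F ` ladder i x)"

definition trace :: "('a set \<Rightarrow> 'a set) \<Rightarrow> 'a set \<Rightarrow> 'a \<Rightarrow> 'a set set" where
  "trace F \<eta> i = (\<Union>n. level F \<eta> i n)"

lemma trace_step: "x \<in> trace F \<eta> i \<Longrightarrow> y \<in> ladder i x \<Longrightarrow> retract F y \<in> trace F \<eta> i"
proof -
  assume "x \<in> trace F \<eta> i" "y \<in> ladder i x"
  then obtain n where "x \<in> level F \<eta> i n" by (auto simp: trace_def)
  then have "retract F y \<in> level F \<eta> i (Suc n)" using \<open>y \<in> ladder i x\<close> by auto
  then show ?thesis unfolding trace_def by blast
qed

lemma trace_start: "retract F \<eta> \<in> trace F \<eta> i"
  unfolding trace_def by (rule UN_I[of 0]) auto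

lemma level_cl:
  assumes "\<eta> \<in> V"
  shows "x \<in> level F \<eta> i n \<Longrightarrow> x \<in> cl F \<and> x \<sqsubseteq> \<eta>"
proof (induction n arbitrary: x)
  case 0
  then show ?case using retract[OF assms] by auto
next
  case (Suc n)
  then obtain z y where z: "z \<in> level F \<eta> i n" "y \<in> ladder i z" "x = retract F y" by auto
  then have "y \<sqsubset> z" using ladder(1) in_underS by blast
  then show ?case using z Suc.IH[OF z(1)] retract(1,2)[of y F] lt_V lt_le le_trans by metis
qed

lemma trace_cl: "\<eta> \<in> V \<Longrightarrow> x \<in> trace F \<eta> i \<Longrightarrow> x \<in> cl F \<and> x \<sqsubseteq> \<eta>"
  unfolding trace_def using level_cl by blast

text \<open>Each level is a union of at most \<open>|underS lam i|\<close> sets of at most that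
  size, and there are countably many levels. Infinity of the segment absorbs both unions.\<close>

lemma trace_card:
  assumes "infinite (underS lam i)"
  shows "|trace F \<eta> i| \<le>o |underS lam i|"
proof -
  have "|level F \<eta> i n| \<le>o |underS lam i|" for n
  proof (induction n)
    case 0
    then show ?case using assms
      by simp (metis card_of_singl_ordLeq finite.emptyI)
  next
    case (Suc n)
    have "|retract F ` ladder i x| \<le>o |underS lam i|" for x
      using ladder(2) card_of_image ordLeq_transitive by blast
    then have "|\<Union>x\<in>level F \<eta> i n. retract F ` ladder i x| \<le>o |underS lam i|"
      by (intro card_of_UNION_ordLeq_infinite[OF assms Suc]) blast
    then show ?case by simp
  qed
  moreover have "|UNIV :: nat set| \<le>o |underS lam i|"
    using assms infinite_iff_card_of_nat by blast
  ultimately show ?thesis unfolding trace_def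
    by (intro card_of_UNION_ordLeq_infinite[OF assms]) simp_all
qed


section \<open>Coding below \<open>lam\<close> and the lifted colouring\<close>

definition enum :: "'a set \<Rightarrow> 'a set \<Rightarrow> 'a" where
  "enum x = (SOME f. inj_on f (underS K x) \<and> f ` underS K x \<subseteq> L)"

lemma enum:
  assumes "x \<in> V"
  shows "inj_on (enum x) (underS K x)" "enum x ` underS K x \<subseteq> L"
proof -
  have "|underS K x| \<le>o |L|"
    using card_underS_le[OF assms] card_L ordIso_symmetric ordLeq_ordIso_trans by blast
  then have "\<exists>f. inj_on f (underS K x) \<and> f ` underS K x \<subseteq> L"
    using card_of_ordLeq by blast
  from someI_ex[OF this] show "inj_on (enum x) (underS K x)" "enum x ` underS K x \<subseteq> L"
    unfolding enum_def by auto
qed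

definition code :: "'a \<times> 'a \<times> 'a \<Rightarrow> 'a" where
  "code = (SOME f. inj_on f (L \<times> L \<times> L) \<and> f ` (L \<times> L \<times> L) \<subseteq> L)"

lemma code: "inj_on code (L \<times> L \<times> L)" "code ` (L \<times> L \<times> L) \<subseteq> L"
proof -
  have "|L \<times> L \<times> L| \<le>o |L|"
    using inf_lam by (intro card_of_Times_ordLeq_infinite_Field) (simp_all add: Field_card_of card_of_card_order_on card_of_mono1)
  then have "\<exists>f. inj_on f (L \<times> L \<times> L) \<and> f ` (L \<times> L \<times> L) \<subseteq> L"
    using card_of_ordLeq by blast
  from someI_ex[OF this] show "inj_on code (L \<times> L \<times> L)" "code ` (L \<times> L \<times> L) \<subseteq> L"
    unfolding code_def by auto
qed

definition decode :: "'a \<Rightarrow> 'a \<times> 'a \<times> 'a" where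
  "decode = inv_into (L \<times> L \<times> L) code"

lemma decode_code: "i \<in> L \<Longrightarrow> j \<in> L \<Longrightarrow> k \<in> L \<Longrightarrow> decode (code (i, j, k)) = (i, j, k)"
  unfolding decode_def using code(1) by (simp add: inv_into_f_f)

definition unenum :: "'a set \<Rightarrow> 'a \<Rightarrow> 'a set" where
  "unenum x = inv_into (underS K x) (enum x)"

lemma unenum: "y \<sqsubset> x \<Longrightarrow> unenum x (enum x y) = y"
  unfolding unenum_def using enum(1) in_underS lt_V(2) by (simp add: inv_into_f_f)

definition reach :: "('a set \<Rightarrow> 'a set) \<Rightarrow> 'a set \<Rightarrow> 'a \<Rightarrow> 'a set set" where
  "reach F \<beta> i = (\<Union>\<eta>\<in>{\<eta>. \<eta> \<sqsubset> \<beta> \<and> (enum \<beta> \<eta>, i) \<in> lam}. trace F \<eta> i)"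

text \<open>Injectivity of \<open>enum \<beta>\<close> leaves at most
  \<open>|insert i (underS lam i)|\<close> many \<open>\<eta>\<close> whose code is at most
  \<open>i\<close>, and each contributes a trace of size at most
  \<open>|underS lam i|\<close>.\<close>

lemma reach_card:
  assumes "infinite (underS lam i)" "\<beta> \<in> V"
  shows "|reach F \<beta> i| \<le>o |underS lam i|"
proof -
  let ?E = "{\<eta>. \<eta> \<sqsubset> \<beta> \<and> (enum \<beta> \<eta>, i) \<in> lam}"
  have "?E \<subseteq> underS K \<beta>" using in_underS by blast
  then have "inj_on (enum \<beta>) ?E" using enum(1)[OF assms(2)] inj_on_subset by blast
  moreover have "enum \<beta> ` ?E \<subseteq> insert i (underS lam i)" by (auto simp: underS_def)
  ultimately have "|?E| \<le>o |insert i (underS lam i)|" using card_of_ordLeq by blast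
  moreover have "|insert i (underS lam i)| \<le>o |underS lam i|"
    by (rule card_insert_le[OF assms(1)]) (simp add: card_of_mono1)
  ultimately have "|?E| \<le>o |underS lam i|" using ordLeq_transitive by blast
  then show ?thesis unfolding reach_def
    by (intro card_of_UNION_ordLeq_infinite[OF assms(1)]) (simp_all add: trace_card[OF assms(1)])
qed

text \<open>The definition refers to \<open>F\<close> and \<open>c\<close> only, so one colouring
  serves all partitions. The description \<open>THE \<delta>\<close> and the inverses behind
  \<open>decode\<close> and \<open>unenum\<close> may return arbitrary values; the final test on
  \<open>v\<close> then keeps the colour inside \<open>V\<close>.\<close>

definition lift :: "('a set \<Rightarrow> 'a set) \<Rightarrow> ('a set \<Rightarrow> 'a set \<Rightarrow> 'a) \<Rightarrow> 'a set \<Rightarrow> 'a set \<Rightarrow> 'a set" where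
  "lift F c \<alpha> \<beta> = (case decode (c \<alpha> \<beta>) of (i, j, k) \<Rightarrow>
     let \<delta> = (THE \<delta>. \<delta> \<in> reach F \<beta> i \<and> \<alpha> \<sqsubset> \<delta> \<and> (\<forall>x\<in>reach F \<beta> i. \<alpha> \<sqsubset> x \<longrightarrow> \<delta> \<sqsubseteq> x));
         v = unenum (unenum \<delta> j) k
     in if v \<in> V then v else (SOME v. v \<in> V))"

lemma colouring_lift: "colouring K V (lift F c)"
proof -
  have "(SOME v. v \<in> V) \<in> V" using inf_V by (metis finite.emptyI someI_ex equals0I)
  then show ?thesis unfolding colouring_def lift_def by (auto simp: Let_def split: prod.split)
qed

end

section \<open>Bounds below a cardinal of uncountable cofinality\<close>

locale uncountable_cofinality = succ_of_card +
  assumes uncountable_cf: "\<And>A. A \<subseteq> L \<Longrightarrow> cofinal A lam \<Longrightarrow> natLeq <o |A|"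
begin

lemma lam_refl: "x \<in> L \<Longrightarrow> (x, x) \<in> lam"
  using wo_lam by (simp add: order_on_defs well_order_on_def refl_on_def)

lemma lam_trans: "(x, y) \<in> lam \<Longrightarrow> (y, z) \<in> lam \<Longrightarrow> (x, z) \<in> lam"
  using wo_lam by (simp add: order_on_defs well_order_on_def) (blast dest: transD)

lemma lam_total: "x \<in> L \<Longrightarrow> y \<in> L \<Longrightarrow> (x, y) \<in> lam \<or> (y, x) \<in> lam"
  using wo_lam lam_refl
  by (cases "x = y") (auto simp add: order_on_defs well_order_on_def total_on_def)

lemma lam_max: "x \<in> L \<Longrightarrow> y \<in> L \<Longrightarrow> \<exists>z\<in>L. (x, z) \<in> lam \<and> (y, z) \<in> lam"
  using lam_total lam_refl by blast

lemma not_cofinal_bound: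
  assumes "A \<subseteq> L" "\<not> cofinal A lam"
  shows "\<exists>i\<in>L. \<forall>a\<in>A. (a, i) \<in> lam"
proof -
  obtain i where i: "i \<in> L" "\<forall>b\<in>A. i = b \<or> (i, b) \<notin> lam"
    using assms(2) unfolding cofinal_def by blast
  have "(a, i) \<in> lam" if a: "a \<in> A" for a
  proof -
    have aL: "a \<in> L" using assms(1) a by (rule subsetD)
    have "i = a \<or> (i, a) \<notin> lam" using i(2) a by (rule bspec)
    then show ?thesis using lam_total[OF aL i(1)] lam_refl[OF aL] by metis
  qed
  then show ?thesis using i(1) by blast
qed

lemma cofinal_L: "cofinal L lam"
  unfolding cofinal_def using infinite_Card_order_limit[OF card_lam inf_lam] by blast

text \<open>A well-order strictly below \<open>lam\<close> is isomorphic to a proper initial segment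
  of it. This is what allows elements of \<open>L\<close> to serve as names for sizes.\<close>

lemma card_below_underS:
  assumes "|A| <o lam"
  shows "\<exists>i\<in>L. |A| \<le>o |underS lam i|"
proof -
  obtain i where i: "i \<in> L" "|A| =o Restr lam (underS lam i)"
    using assms ordLess_iff_ordIso_Restr[OF wo_lam card_of_Well_order] by blast
  have "Field (Restr lam (underS lam i)) \<subseteq> underS lam i" by (rule Field_Restr_subset)
  moreover have "|Field |A| | \<le>o |Field (Restr lam (underS lam i))|"
    using i(2) ordIso_iff_ordLeq card_of_mono2 by blast
  ultimately have "|A| \<le>o |underS lam i|"
    using card_of_mono1 ordLeq_transitive unfolding Field_card_of by blast
  then show ?thesis using i(1) by blast
qed

lemma underS_lam_mono: "(i, j) \<in> lam \<Longrightarrow> |underS lam i| \<le>o |underS lam j|"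
proof -
  assume "(i, j) \<in> lam"
  then have "underS lam i \<subseteq> underS lam j"
    using wo_lam lam_trans unfolding underS_def
    by (auto simp: order_on_defs well_order_on_def dest: antisymD)
  then show ?thesis by (rule card_of_mono1)
qed

text \<open>\<open>L\<close> is cofinal in itself, hence uncountable, so some proper segment already
  has room for the natural numbers. Segments further up are at least as large.\<close>

lemma large_index: "\<exists>i\<in>L. \<forall>j. (i, j) \<in> lam \<longrightarrow> infinite (underS lam j)"
proof -
  have "natLeq <o |L|" using uncountable_cf cofinal_L by blast
  then have "|UNIV :: nat set| <o lam"
    using card_L card_of_nat ordIso_ordLess_trans ordLess_ordIso_trans by blast
  then obtain i where i: "i \<in> L" "|UNIV :: nat set| \<le>o |underS lam i|"
    using card_below_underS by blast
  then have "infinite (underS lam j)" if "(i, j) \<in> lam" for j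
    using underS_lam_mono[OF that] ordLeq_transitive infinite_iff_card_of_nat by blast
  then show ?thesis using i(1) by blast
qed

section \<open>Guessing clubs along traces\<close>

text \<open>A single \<open>\<eta>\<close> must work for all \<open>i0\<close>: in the application
  \<open>i0\<close> depends on a set \<open>b\<close> that is chosen only after
  \<open>\<eta>\<close>.\<close>

definition guesses :: "('a set \<Rightarrow> 'a set) \<Rightarrow> ('a set \<Rightarrow> 'a set) \<Rightarrow> bool" where
  "guesses F G \<longleftrightarrow> (\<exists>\<eta>\<in>V. \<forall>i0\<in>L. \<exists>i. (i0, i) \<in> lam \<and> infinite (underS lam i) \<and>
     (\<exists>\<delta>\<in>trace F \<eta> i. \<delta> \<in> cl G \<and> bigcof i \<delta>))"

definition join :: "'a set \<Rightarrow> 'a set \<Rightarrow> 'a set" where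
  "join x y = (if x \<sqsubseteq> y then y else x)"

lemma join: "x \<in> V \<Longrightarrow> y \<in> V \<Longrightarrow> join x y \<in> V \<and> x \<sqsubseteq> join x y \<and> y \<sqsubseteq> join x y"
  unfolding join_def
  using le_refl[of x] le_refl[of y] le_or_lt[of x y] lt_le[of y x] by auto

lemma cl_antimono:
  assumes "\<And>x. x \<in> V \<Longrightarrow> F x \<sqsubseteq> G x"
  shows "cl G \<subseteq> cl F"
  unfolding cl_def using assms le_trans lt_V(1) by blast

lemma decreasing_stabilises:
  fixes f :: "nat \<Rightarrow> 'a set"
  assumes "\<And>n. f n \<in> V" "\<And>m n. m \<le> n \<Longrightarrow> f n \<sqsubseteq> f m"
  shows "\<exists>N. \<forall>n\<ge>N. f n = f N"
proof -
  obtain m where m: "m \<in> range f" "\<And>y. y \<in> V \<Longrightarrow> y \<in> range f \<Longrightarrow> m \<sqsubseteq> y"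
    by (rule least_ex[of "f 0" "\<lambda>x. x \<in> range f", OF assms(1)]) simp_all
  then obtain N where N: "m = f N" by blast
  have "f n = f N" if "n \<ge> N" for n
    using m(2)[OF assms(1), of n] assms(2)[OF that] le_antisym N by simp
  then show ?thesis by blast
qed

text \<open>A pointwise upper bound of countably many functions represents a common subclub: its
  closed points lie in every \<open>cl (F n)\<close>.\<close>

lemma countable_join:
  fixes F :: "nat \<Rightarrow> 'a set \<Rightarrow> 'a set"
  assumes "\<And>n x. x \<in> V \<Longrightarrow> F n x \<in> V"
  obtains H where "\<And>x. x \<in> V \<Longrightarrow> H x \<in> V" "\<And>n x. x \<in> V \<Longrightarrow> F n x \<sqsubseteq> H x"
proof -
  have "\<exists>u\<in>V. \<forall>n. F n x \<sqsubseteq> u" if "x \<in> V" for x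
  proof -
    have "|range (\<lambda>n. F n x)| \<le>o lam"
      using card_of_image[of "\<lambda>n. F n x" UNIV] infinite_iff_card_of_nat inf_lam card_L
      by (meson ordLeq_ordIso_trans ordLeq_transitive)
    then show ?thesis using bounded_of_card_le[of "range (\<lambda>n. F n x)"] assms[OF that] lt_le by blast
  qed
  then have "\<forall>x\<in>V. \<exists>u. u \<in> V \<and> (\<forall>n. F n x \<sqsubseteq> u)" by blast
  from bchoice[OF this] obtain H where "\<forall>x\<in>V. H x \<in> V \<and> (\<forall>n. F n x \<sqsubseteq> H x)" ..
  then show thesis using that[of H] by blast
qed

text \<open>If no F works, iterate counterexamples \<omega> times. Each descent towards a fixed point a in all
  the clubs stabilises at a finite stage, so the least point above a that is eventually in the trace
  is a common point of the clubs, of large cofinality. Uncountable cofinality of lam provides one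
  size i that is large enough for all \<omega> counterexamples.\<close>

lemma guessing:
  "\<exists>F. \<forall>G. (\<forall>x\<in>V. G x \<in> V) \<longrightarrow> guesses F G"
proof (rule ccontr)
  assume "\<nexists>F. \<forall>G. (\<forall>x\<in>V. G x \<in> V) \<longrightarrow> guesses F G"
  then have "\<forall>F. \<exists>G. (\<forall>x\<in>V. G x \<in> V) \<and> \<not> guesses F G" by blast
  from choice[OF this] obtain G where
    G: "\<And>F x. x \<in> V \<Longrightarrow> G F x \<in> V" "\<And>F. \<not> guesses F (G F)" by blast
  \<comment> \<open>The iteration starts from the identity, whose closed points are all of
    \<open>V\<close>. Each stage is joined with the counterexample to the guessing property of that
    stage, so the clubs decrease and enter the missed ones.\<close>
  define F where "F = rec_nat (\<lambda>x. x) (\<lambda>n f x. join (f x) (G f x))"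
  have F0: "F 0 = (\<lambda>x. x)" and FS: "F (Suc n) = (\<lambda>x. join (F n x) (G (F n) x))" for n
    by (simp_all add: F_def)
  have FV: "F n x \<in> V" if "x \<in> V" for n x
    using that by (induction n) (auto simp: F0 FS G(1) join)
  have Fmono: "F m x \<sqsubseteq> F n x" if "m \<le> n" "x \<in> V" for m n x
    using that(1)
  proof (induction n rule: dec_induct)
    case base then show ?case using FV le_refl that(2) by blast
  next
    case (step n) then show ?case using FV G(1) join le_trans that(2) unfolding FS by blast
  qed
  have clG: "cl (F (Suc n)) \<subseteq> cl (G (F n))" for n
    by (rule cl_antimono) (simp add: FS FV G(1) join)
  have clF: "cl (F n) \<subseteq> cl (F m)" if "m \<le> n" for m n
    by (rule cl_antimono) (rule Fmono[OF that])
  obtain H where H: "\<And>x. x \<in> V \<Longrightarrow> H x \<in> V" "\<And>n x. x \<in> V \<Longrightarrow> F n x \<sqsubseteq> H x"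
    using countable_join[of F] FV by blast
  have clH: "cl H \<subseteq> cl (F n)" for n by (rule cl_antimono) (rule H(2))
  have "\<forall>i. \<exists>\<delta>. i \<in> L \<and> infinite (underS lam i) \<longrightarrow> \<delta> \<in> cl H \<and> bigcof i \<delta>"
    using bigcof_in_cl H(1) by blast
  then obtain d where d: "\<And>i. i \<in> L \<Longrightarrow> infinite (underS lam i) \<Longrightarrow> d i \<in> cl H \<and> bigcof i (d i)"
    by metis
  let ?I = "{i\<in>L. infinite (underS lam i)}"
  have "|d ` ?I| \<le>o |L|" using card_of_image card_of_mono1[of ?I L] ordLeq_transitive by blast
  then have "|d ` ?I| \<le>o lam" using card_L ordLeq_ordIso_trans by blast
  \<comment> \<open>The index \<open>i\<close> is determined only after \<open>\<eta>\<close>, so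
    \<open>\<eta>\<close> is put above a suitable point \<open>d i\<close> for every possible
    \<open>i\<close> at once.\<close>
  then obtain \<eta> where \<eta>: "\<eta> \<in> V" "\<forall>y\<in>d ` ?I. y \<sqsubset> \<eta>"
    using bounded_of_card_le[of "d ` ?I"] d cl_V by blast
  have "\<forall>n. \<exists>i0\<in>L. \<forall>i \<delta>. (i0, i) \<in> lam \<and> infinite (underS lam i) \<and> \<delta> \<in> trace (F n) \<eta> i
      \<and> bigcof i \<delta> \<longrightarrow> \<delta> \<notin> cl (G (F n))"
    using G(2) \<eta>(1) unfolding guesses_def by blast
  then obtain i0 where i0: "\<And>n. i0 n \<in> L" "\<And>n i \<delta>. (i0 n, i) \<in> lam \<Longrightarrow> infinite (underS lam i) \<Longrightarrow>
      \<delta> \<in> trace (F n) \<eta> i \<Longrightarrow> bigcof i \<delta> \<Longrightarrow> \<delta> \<notin> cl (G (F n))"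
    by metis
  have "|range i0| \<le>o natLeq"
    using card_of_image card_of_nat ordLeq_ordIso_trans by blast
  then have "\<not> cofinal (range i0) lam"
    using uncountable_cf[of "range i0"] i0(1) not_ordLess_ordLeq by blast
  then obtain i1 where i1: "i1 \<in> L" "\<And>n. (i0 n, i1) \<in> lam"
    using not_cofinal_bound[of "range i0"] i0(1) by blast
  obtain i2 where i2: "i2 \<in> L" "\<And>j. (i2, j) \<in> lam \<Longrightarrow> infinite (underS lam j)"
    using large_index by blast
  obtain i where i: "i \<in> L" "(i1, i) \<in> lam" "(i2, i) \<in> lam" using lam_max i1(1) i2(1) by blast
  have inf: "infinite (underS lam i)" using i2 i by blast
  let ?a = "d i"
  have a: "?a \<in> cl H" "bigcof i ?a" "?a \<sqsubset> \<eta>" using d inf i(1) \<eta>(2) by blast+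
  \<comment> \<open>The clubs \<open>cl (F n)\<close> decrease, hence so do the retractions of a
    fixed \<open>y\<close>; a decreasing sequence of ordinals is eventually constant. It never drops
    below \<open>d i\<close>, which lies in all the clubs.\<close>
  have stab: "\<exists>x N. ?a \<sqsubseteq> x \<and> x \<sqsubseteq> y \<and> (\<forall>n\<ge>N. retract (F n) y = x)" if y: "?a \<sqsubseteq> y" for y
  proof -
    have yV: "y \<in> V" using y le_V by blast
    have "\<exists>N. \<forall>n\<ge>N. retract (F n) y = retract (F N) y"
    proof (rule decreasing_stabilises)
      fix m n :: nat
      show "retract (F n) y \<in> V" using retract(1)[OF yV] cl_V by blast
      assume "m \<le> n"
      then show "retract (F n) y \<sqsubseteq> retract (F m) y"
        using retract[OF yV] clF by blast
    qed
    then obtain N where "\<forall>n\<ge>N. retract (F n) y = retract (F N) y" ..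
    moreover have "?a \<sqsubseteq> retract (F N) y" "retract (F N) y \<sqsubseteq> y"
      using retract[OF yV] clH a(1) y by blast+
    ultimately show ?thesis by blast
  qed
  let ?P = "\<lambda>x. ?a \<sqsubseteq> x \<and> (\<exists>N. \<forall>n\<ge>N. x \<in> trace (F n) \<eta> i)"
  obtain x0 N0 where "?a \<sqsubseteq> x0" "\<forall>n\<ge>N0. retract (F n) \<eta> = x0" using stab[OF lt_le[OF a(3)]] by blast
  then have x0: "?P x0" using trace_start by metis
  then have "x0 \<in> V" using le_V by blast
  obtain x where x: "?P x" "\<And>y. y \<in> V \<Longrightarrow> ?P y \<Longrightarrow> x \<sqsubseteq> y"
    by (rule least_ex[of x0 ?P, OF \<open>x0 \<in> V\<close> x0]) simp
  obtain N where N: "\<And>n. n \<ge> N \<Longrightarrow> x \<in> trace (F n) \<eta> i" using x(1) by blast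
  show False
  proof (cases "bigcof i x")
    case True
    \<comment> \<open>Two consecutive stages are combined: membership in the trace at stage
      \<open>Suc N\<close> places \<open>x\<close> in the club missed at stage \<open>N\<close>,
      while \<open>x\<close> is also in the trace at stage \<open>N\<close>. This contradicts the
      choice of \<open>i0 N\<close>.\<close>
    have "x \<in> cl (F (Suc N))" using trace_cl[OF \<eta>(1)] N[of "Suc N"] by simp
    then have "x \<in> cl (G (F N))" using clG by blast
    moreover have "(i0 N, i) \<in> lam" using i1(2) i(2) lam_trans by blast
    ultimately show False using i0(2)[OF _ inf N[of N] True] by simp
  next
    case False
    \<comment> \<open>\<open>bigcof\<close> separates \<open>x\<close> from \<open>?a\<close>, so
      the ladder of \<open>x\<close> has a rung above \<open>?a\<close>. The stable retraction of
      that rung satisfies \<open>?P\<close> and lies below \<open>x\<close>, against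
      minimality.\<close>
    then have "?a \<sqsubset> x" using x(1) a(2) by (auto simp: olt_def)
    then obtain y where y: "y \<in> ladder i x" "\<not> y \<sqsubseteq> ?a" using ladder_not_bigcof(3)[OF False] by blast
    have yx: "y \<sqsubset> x" using y(1) ladder(1) in_underS by blast
    have "?a \<sqsubseteq> y" using y(2) le_or_lt[of y ?a] yx lt_V cl_V[OF a(1)] lt_le by blast
    then obtain z M where z: "?a \<sqsubseteq> z" "z \<sqsubseteq> y" "\<And>n. n \<ge> M \<Longrightarrow> retract (F n) y = z" using stab by blast
    have "z \<in> trace (F n) \<eta> i" if "n \<ge> max N M" for n
      using trace_step[OF N y(1), of n] z(3)[of n] that by simp
    then have "?P z" using z(1) by blast
    then have "x \<sqsubseteq> z" using x(2) z(1) le_V by blast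
    then show False using z(2) yx le_trans not_lt_le by blast
  qed
qed

end

section \<open>Disjoint families of sets smaller than the cofinality\<close>

locale below_cofinality = uncountable_cofinality lam for lam :: "'a rel" +
  fixes chi :: "'c rel"
  assumes chi_le_cf: "\<And>A. A \<subseteq> L \<Longrightarrow> cofinal A lam \<Longrightarrow> chi \<le>o |A|"
begin

lemma family_sub: "good_family K \<sigma> A \<Longrightarrow> a \<in> A \<Longrightarrow> a \<subseteq> V"
  unfolding good_family_def by blast

lemma subfamily:
  "good_family K \<sigma> A \<Longrightarrow> A' \<subseteq> A \<Longrightarrow> |A'| =o K \<Longrightarrow> good_family K \<sigma> A'"
  unfolding good_family_def using pairwise_subset by blast

lemma Field_Restr_K: "a \<subseteq> V \<Longrightarrow> Field (Restr K a) = a"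
  using le_refl by (fastforce simp: Field_def)

lemma family_card:
  assumes "good_family K \<sigma> A" "a \<in> A"
  shows "|a| \<le>o \<sigma>"
proof -
  have iso: "Restr K a =o \<sigma>" and sub: "a \<subseteq> V" using assms unfolding good_family_def by blast+
  have "Well_order (Restr K a)" using wo_K Well_order_Restr by blast
  then have "|Field (Restr K a)| \<le>o Restr K a" by (rule card_of_least)
  then have "|a| \<le>o Restr K a" by (simp only: Field_Restr_K[OF sub])
  then show ?thesis using iso ordLeq_ordIso_trans by blast
qed

text \<open>All members share one order type, so one empty member would make all empty. The family
  would then have at most one member instead of \<open>K\<close> many.\<close>

lemma family_ne:
  assumes "good_family K \<sigma> A" "a \<in> A"
  shows "a \<noteq> {}"
proof
  assume "a = {}"
  have "x = {}" if x: "x \<in> A" for x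
  proof -
    have "Restr K x =o \<sigma>" "Restr K a =o \<sigma>" "x \<subseteq> V"
      using assms x unfolding good_family_def by blast+
    then have "Restr K x \<le>o Restr K a"
      using ordIso_symmetric ordIso_transitive ordIso_iff_ordLeq by blast
    then have "|Field (Restr K x)| \<le>o |Field (Restr K a)|" by (rule card_of_mono2)
    then have "|x| \<le>o |{} :: 'a set set|"
      using Field_Restr_K[OF \<open>x \<subseteq> V\<close>] \<open>a = {}\<close> by simp
    then show ?thesis by (rule card_of_empty3)
  qed
  then have "A \<subseteq> {{}}" by blast
  then have "finite A" using finite_subset by blast
  moreover have "|A| =o |V|"
    using assms(1) card_of_Field_ordIso[OF card_K] ordIso_symmetric ordIso_transitive
    unfolding good_family_def by blast
  ultimately show False using card_of_ordIso_finite inf_V by blast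
qed

lemma family_large: "good_family K \<sigma> A \<Longrightarrow> \<not> |A| \<le>o lam"
proof
  assume "good_family K \<sigma> A" and le: "|A| \<le>o lam"
  then have "K =o |A|" using ordIso_symmetric unfolding good_family_def by blast
  then have "K \<le>o lam" using le ordIso_ordLeq_trans by blast
  then show False using cardSuc_greater[OF card_lam] not_ordLess_ordLeq by blast
qed

text \<open>Otherwise choosing from each member a point up to \<open>\<epsilon>\<close> would, by
  disjointness, inject the family into a set of size at most \<open>lam\<close>.\<close>

lemma family_above:
  assumes A: "good_family K \<sigma> A" and "\<epsilon> \<in> V"
  shows "\<exists>a\<in>A. \<forall>\<alpha>\<in>a. \<epsilon> \<sqsubset> \<alpha>"
proof (rule ccontr)
  assume "\<not> ?thesis"
  then have "\<forall>a\<in>A. \<exists>\<alpha>. \<alpha> \<in> a \<and> \<not> \<epsilon> \<sqsubset> \<alpha>" by blast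
  from bchoice[OF this] obtain f where f: "\<forall>a\<in>A. f a \<in> a \<and> \<not> \<epsilon> \<sqsubset> f a" ..
  have below: "f a \<sqsubseteq> \<epsilon>" if "a \<in> A" for a
    using f that le_or_lt[of "f a" \<epsilon>] family_sub[OF A that] \<open>\<epsilon> \<in> V\<close> by blast
  have "inj_on f A"
  proof (rule inj_onI)
    fix a b assume "a \<in> A" "b \<in> A" "f a = f b"
    then show "a = b"
      using A f unfolding good_family_def pairwise_def disjnt_def by (metis disjoint_iff)
  qed
  then have "|A| \<le>o |{y. y \<sqsubseteq> \<epsilon>}|" by (rule card_of_ordLeqI) (simp add: below)
  then have "|A| \<le>o lam" using card_under_le[OF \<open>\<epsilon> \<in> V\<close>] ordLeq_transitive by blast
  then show False using family_large[OF A] by blast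
qed

lemma small_not_cofinal:
  assumes "\<sigma> <o chi" "|X| \<le>o \<sigma>" "X \<subseteq> L"
  shows "\<not> cofinal X lam"
proof
  assume "cofinal X lam"
  then have "chi \<le>o |X|" using chi_le_cf assms(3) by blast
  then have "chi \<le>o \<sigma>" using assms(2) ordLeq_transitive by blast
  then show False using assms(1) not_ordLess_ordLeq by blast
qed

lemma small_less_lam:
  assumes "\<sigma> <o chi" "|a| \<le>o \<sigma>"
  shows "|a| <o lam"
proof -
  have "|a| <o chi" using assms ordLeq_ordLess_trans by blast
  moreover have "chi \<le>o |L|" using chi_le_cf cofinal_L by blast
  ultimately have "|a| <o |L|" using ordLess_ordLeq_trans by blast
  then show ?thesis using card_L ordLess_ordIso_trans by blast
qed

lemma family_bounded:
  assumes "\<sigma> <o chi" "good_family K \<sigma> A" "a \<in> A"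
  shows "\<exists>u\<in>V. \<forall>\<alpha>\<in>a. \<alpha> \<sqsubset> u"
  using bounded_of_card_le[OF family_sub[OF assms(2,3)]]
    small_less_lam[OF assms(1) family_card[OF assms(2,3)]] ordLess_imp_ordLeq by blast

text \<open>Since \<open>H \<epsilon>\<close> bounds \<open>f \<epsilon>\<close>, indices in
  \<open>cl H\<close> separate the chosen sets: for
  \<open>\<epsilon> \<sqsubset> \<epsilon>'\<close> the set \<open>f \<epsilon>\<close> lies below
  \<open>\<epsilon>'\<close> and \<open>f \<epsilon>'\<close> above it. Hence \<open>f\<close> is
  injective there and the subfamily keeps full size.\<close>

lemma sparse_subfamily:
  assumes A: "good_family K \<sigma> A" and \<rho>: "\<rho> \<in> V"
    and f: "\<And>\<epsilon>. \<epsilon> \<in> V \<Longrightarrow> f \<epsilon> \<in> A \<and> (\<forall>\<alpha>\<in>f \<epsilon>. \<epsilon> \<sqsubset> \<alpha>)"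
    and H: "\<And>\<epsilon>. \<epsilon> \<in> V \<Longrightarrow> H \<epsilon> \<in> V" "\<And>\<epsilon> \<alpha>. \<epsilon> \<in> V \<Longrightarrow> \<alpha> \<in> f \<epsilon> \<Longrightarrow> \<alpha> \<sqsubset> H \<epsilon>"
  shows "good_family K \<sigma> (f ` {\<epsilon>\<in>cl H. \<rho> \<sqsubset> \<epsilon>})"
    and "\<And>\<epsilon> \<epsilon>' \<alpha>. \<epsilon>' \<in> cl H \<Longrightarrow> \<epsilon> \<sqsubset> \<epsilon>' \<Longrightarrow> \<alpha> \<in> f \<epsilon> \<Longrightarrow> \<alpha> \<sqsubset> \<epsilon>'"
proof -
  let ?Z = "{\<epsilon>\<in>cl H. \<rho> \<sqsubset> \<epsilon>}"
  show below: "\<alpha> \<sqsubset> \<epsilon>'" if "\<epsilon>' \<in> cl H" "\<epsilon> \<sqsubset> \<epsilon>'" "\<alpha> \<in> f \<epsilon>" for \<epsilon> \<epsilon>' \<alpha>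
  proof -
    have "\<alpha> \<sqsubset> H \<epsilon>" using H(2) that lt_V by blast
    moreover have "H \<epsilon> \<sqsubseteq> \<epsilon>'" using that unfolding cl_def by blast
    ultimately show ?thesis by (rule lt_le_trans)
  qed
  have neq: "f \<epsilon> \<noteq> f \<epsilon>'" if e: "\<epsilon>' \<in> cl H" "\<epsilon> \<sqsubset> \<epsilon>'" for \<epsilon> \<epsilon>'
  proof
    assume eq: "f \<epsilon> = f \<epsilon>'"
    have "\<epsilon> \<in> V" using lt_V(1)[OF e(2)] .
    then obtain \<alpha> where \<alpha>: "\<alpha> \<in> f \<epsilon>" using f family_ne[OF A] by blast
    then have "\<epsilon>' \<sqsubset> \<alpha>" using f[OF cl_V[OF e(1)]] eq by blast
    then show False using below[OF e \<alpha>] lt_le not_lt_le by blast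
  qed
  have "inj_on f ?Z"
  proof (rule inj_onI)
    fix x y assume "x \<in> ?Z" "y \<in> ?Z" "f x = f y"
    then show "x = y"
      using neq[of x y] neq[of y x] le_or_lt[of x y] cl_V by (auto simp: olt_def)
  qed
  then have "|f ` ?Z| =o |?Z|" using inj_on_imp_bij_betw card_of_ordIsoI ordIso_symmetric by blast
  moreover have "|?Z| =o K"
  proof (rule unbounded_card)
    show "?Z \<subseteq> V" using cl_V by blast
    fix x assume x: "x \<in> V"
    obtain \<delta> where \<delta>: "\<delta> \<in> cl H" "join x \<rho> \<sqsubset> \<delta>" using cl_unbounded[of H "join x \<rho>"] H(1) join[OF x \<rho>] by blast
    then show "\<exists>z\<in>?Z. x \<sqsubseteq> z" using join[OF x \<rho>] le_lt_trans lt_le by blast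
  qed
  ultimately have "|f ` ?Z| =o K" by (rule ordIso_transitive)
  then show "good_family K \<sigma> (f ` ?Z)"
    by (intro subfamily[OF A]) (use f cl_V in blast)+
qed

text \<open>After thinning, \<open>fa \<epsilon>\<close> can precede \<open>fb \<epsilon>'\<close>
  only if \<open>\<epsilon> \<sqsubset> \<epsilon>'\<close>: the reverse order of indices puts
  \<open>fb \<epsilon>'\<close> below \<open>\<epsilon>\<close>, and equal indices are excluded by
  \<open>no\<close>. The relation \<open>set_lt\<close> thus locates \<open>fa \<epsilon>\<close>
  below the index \<open>\<epsilon>'\<close>.\<close>

lemma interleave:
  assumes A: "good_family K \<sigma> A" and B: "good_family K \<sigma> B" and \<sigma>: "\<sigma> <o chi" and \<rho>: "\<rho> \<in> V"
    and fa: "\<And>\<epsilon>. \<epsilon> \<in> V \<Longrightarrow> fa \<epsilon> \<in> A \<and> (\<forall>\<alpha>\<in>fa \<epsilon>. \<epsilon> \<sqsubset> \<alpha>)"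
    and fb: "\<And>\<epsilon>. \<epsilon> \<in> V \<Longrightarrow> fb \<epsilon> \<in> B \<and> (\<forall>\<beta>\<in>fb \<epsilon>. \<epsilon> \<sqsubset> \<beta>)"
    and no: "\<And>\<epsilon>. \<epsilon> \<in> V \<Longrightarrow> \<not> set_lt K (fa \<epsilon>) (fb \<epsilon>)"
  shows "\<exists>Z\<subseteq>V. good_family K \<sigma> (fa ` Z) \<and> good_family K \<sigma> (fb ` Z) \<and>
    (\<forall>\<epsilon>\<in>Z. \<forall>\<epsilon>'\<in>Z. set_lt K (fa \<epsilon>) (fb \<epsilon>') \<longrightarrow> (\<forall>\<alpha>\<in>fa \<epsilon>. \<rho> \<sqsubset> \<alpha> \<and> \<alpha> \<sqsubset> \<epsilon>'))"
proof -
  have "\<forall>\<epsilon>\<in>V. \<exists>h. h \<in> V \<and> (\<forall>\<alpha>\<in>fa \<epsilon> \<union> fb \<epsilon>. \<alpha> \<sqsubset> h)"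
  proof
    fix \<epsilon> assume "\<epsilon> \<in> V"
    then obtain u v where uv: "u \<in> V" "\<forall>\<alpha>\<in>fa \<epsilon>. \<alpha> \<sqsubset> u" "v \<in> V" "\<forall>\<alpha>\<in>fb \<epsilon>. \<alpha> \<sqsubset> v"
      using family_bounded[OF \<sigma> A] family_bounded[OF \<sigma> B] fa fb by meson
    then show "\<exists>h. h \<in> V \<and> (\<forall>\<alpha>\<in>fa \<epsilon> \<union> fb \<epsilon>. \<alpha> \<sqsubset> h)"
      using join[of u v] lt_le_trans by (intro exI[of _ "join u v"]) blast
  qed
  from bchoice[OF this] obtain H where H: "\<forall>\<epsilon>\<in>V. H \<epsilon> \<in> V \<and> (\<forall>\<alpha>\<in>fa \<epsilon> \<union> fb \<epsilon>. \<alpha> \<sqsubset> H \<epsilon>)" ..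
  let ?Z = "{\<epsilon>\<in>cl H. \<rho> \<sqsubset> \<epsilon>}"
  have HV: "\<And>\<epsilon>. \<epsilon> \<in> V \<Longrightarrow> H \<epsilon> \<in> V" and Ha: "\<And>\<epsilon> \<alpha>. \<epsilon> \<in> V \<Longrightarrow> \<alpha> \<in> fa \<epsilon> \<Longrightarrow> \<alpha> \<sqsubset> H \<epsilon>"
    and Hb: "\<And>\<epsilon> \<alpha>. \<epsilon> \<in> V \<Longrightarrow> \<alpha> \<in> fb \<epsilon> \<Longrightarrow> \<alpha> \<sqsubset> H \<epsilon>" using H by blast+
  note a = sparse_subfamily[where f = fa and H = H, OF A \<rho> fa HV Ha]
    and b = sparse_subfamily[where f = fb and H = H, OF B \<rho> fb HV Hb]
  have "\<rho> \<sqsubset> \<alpha> \<and> \<alpha> \<sqsubset> \<epsilon>'"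
    if e: "\<epsilon> \<in> ?Z" "\<epsilon>' \<in> ?Z" "set_lt K (fa \<epsilon>) (fb \<epsilon>')" "\<alpha> \<in> fa \<epsilon>" for \<epsilon> \<epsilon>' \<alpha>
  proof -
    have V: "\<epsilon> \<in> V" "\<epsilon>' \<in> V" using e cl_V by blast+
    have \<alpha>: "\<epsilon> \<sqsubset> \<alpha>" using fa[OF V(1)] e(4) by blast
    obtain \<beta> where \<beta>: "\<beta> \<in> fb \<epsilon>'" using fb[OF V(2)] family_ne[OF B] by blast
    then have "\<alpha> \<sqsubset> \<beta>" using e(3,4) unfolding set_lt_def by blast
    have "\<not> \<epsilon>' \<sqsubset> \<epsilon>"
    proof
      assume "\<epsilon>' \<sqsubset> \<epsilon>"
      then have "\<beta> \<sqsubset> \<epsilon>" using b(2) e(1) \<beta> by blast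
      then show False using \<alpha> \<open>\<alpha> \<sqsubset> \<beta>\<close> lt_le_trans lt_le not_lt_le by blast
    qed
    moreover have "\<epsilon> \<noteq> \<epsilon>'" using no[OF V(1)] e(3) by blast
    ultimately have "\<epsilon> \<sqsubset> \<epsilon>'" using le_or_lt[OF V] by (auto simp: olt_def)
    then have "\<alpha> \<sqsubset> \<epsilon>'" using a(2) e(2,4) by blast
    moreover have "\<rho> \<sqsubset> \<alpha>" using e(1) \<alpha> lt_le_trans lt_le by blast
    ultimately show ?thesis by blast
  qed
  then show ?thesis using a(1) b(1) cl_V by (intro exI[of _ ?Z]) blast
qed

section \<open>Reflecting the colouring hypothesis below a point\<close>

definition hit ::
  "('a set \<Rightarrow> 'a set \<Rightarrow> 'm) \<Rightarrow> ('a set \<Rightarrow> 'a set \<Rightarrow> 'a) \<Rightarrow> 'a set set set \<Rightarrow> ('m \<Rightarrow> 'a) \<Rightarrow>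
    'a set \<Rightarrow> 'a set \<Rightarrow> 'a set set \<Rightarrow> bool"
where
  "hit p c A \<tau> \<rho> \<epsilon> b \<longleftrightarrow>
     (\<exists>a\<in>A. (\<forall>\<alpha>\<in>a. \<rho> \<sqsubset> \<alpha> \<and> \<alpha> \<sqsubset> \<epsilon>) \<and> (\<forall>\<alpha>\<in>a. \<forall>\<beta>\<in>b. c \<alpha> \<beta> = \<tau> (p \<alpha> \<beta>)))"

text \<open>The common consequence of \<open>pr1\<close> (with \<open>A = B\<close>) and
  \<open>pr1_circ\<close> from which both claims are derived. The bound \<open>\<epsilon>\<close> is
  uniform in \<open>b\<close>, so it can be closed off before \<open>b\<close> is chosen.\<close>

definition reflects ::
  "'m set \<Rightarrow> ('a set \<Rightarrow> 'a set \<Rightarrow> 'm) \<Rightarrow> ('a set \<Rightarrow> 'a set \<Rightarrow> 'a) \<Rightarrow> 'a set set set \<Rightarrow> 'a set set set \<Rightarrow> bool"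
where
  "reflects M p c A B \<longleftrightarrow> (\<forall>\<tau>. \<tau> ` M \<subseteq> L \<longrightarrow> (\<forall>\<rho>\<in>V. \<exists>\<epsilon>\<in>V. \<forall>b\<in>B.
     (\<forall>\<beta>\<in>b. \<epsilon> \<sqsubset> \<beta>) \<longrightarrow> hit p c A \<tau> \<rho> \<epsilon> b))"

lemma not_reflects:
  assumes "\<not> reflects M p c A B"
  shows "\<exists>\<tau> \<rho> fb. \<tau> ` M \<subseteq> L \<and> \<rho> \<in> V \<and>
    (\<forall>\<epsilon>\<in>V. (fb \<epsilon> \<in> B \<and> (\<forall>\<beta>\<in>fb \<epsilon>. \<epsilon> \<sqsubset> \<beta>)) \<and> \<not> hit p c A \<tau> \<rho> \<epsilon> (fb \<epsilon>))"
proof -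
  obtain \<tau> where \<tau>: "\<tau> ` M \<subseteq> L" and "\<not> (\<forall>\<rho>\<in>V. \<exists>\<epsilon>\<in>V. \<forall>b\<in>B.
      (\<forall>\<beta>\<in>b. \<epsilon> \<sqsubset> \<beta>) \<longrightarrow> hit p c A \<tau> \<rho> \<epsilon> b)"
    using assms unfolding reflects_def not_all not_imp by (elim exE conjE)
  then obtain \<rho> where \<rho>: "\<rho> \<in> V" and
    "\<not> (\<exists>\<epsilon>\<in>V. \<forall>b\<in>B. (\<forall>\<beta>\<in>b. \<epsilon> \<sqsubset> \<beta>) \<longrightarrow> hit p c A \<tau> \<rho> \<epsilon> b)" by blast
  then have "\<forall>\<epsilon>\<in>V. \<exists>b. (b \<in> B \<and> (\<forall>\<beta>\<in>b. \<epsilon> \<sqsubset> \<beta>)) \<and> \<not> hit p c A \<tau> \<rho> \<epsilon> b" by blast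
  from bchoice[OF this] obtain fb where
    "\<forall>\<epsilon>\<in>V. (fb \<epsilon> \<in> B \<and> (\<forall>\<beta>\<in>fb \<epsilon>. \<epsilon> \<sqsubset> \<beta>)) \<and> \<not> hit p c A \<tau> \<rho> \<epsilon> (fb \<epsilon>)" ..
  with \<tau> \<rho> show ?thesis by (intro exI conjI)
qed

text \<open>A failure supplies for every \<open>\<epsilon>\<close> a member
  \<open>f \<epsilon>\<close> above \<open>\<epsilon>\<close> that is not hit below
  \<open>\<epsilon>\<close>. Applying \<open>pr1\<close> to a thinned family of these members
  produces \<open>f \<epsilon>\<close> between \<open>\<rho>\<close> and \<open>\<epsilon>'\<close>
  with the right colours against \<open>f \<epsilon>'\<close>, which is a hit.\<close>

lemma pr1_reflects:
  fixes \<sigma> :: "'c rel"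
  assumes c: "pr1 K L chi M p c" and \<sigma>: "Well_order \<sigma>" "\<sigma> <o chi" and A: "good_family K \<sigma> A"
  shows "reflects M p c A A"
proof (rule ccontr)
  assume "\<not> reflects M p c A A"
  from not_reflects[OF this] obtain \<tau> \<rho> f where \<tau>: "\<tau> ` M \<subseteq> L" and \<rho>: "\<rho> \<in> V"
    and "\<forall>\<epsilon>\<in>V. (f \<epsilon> \<in> A \<and> (\<forall>\<beta>\<in>f \<epsilon>. \<epsilon> \<sqsubset> \<beta>)) \<and> \<not> hit p c A \<tau> \<rho> \<epsilon> (f \<epsilon>)"
    by (elim exE conjE)
  then have f: "\<And>\<epsilon>. \<epsilon> \<in> V \<Longrightarrow> f \<epsilon> \<in> A \<and> (\<forall>\<beta>\<in>f \<epsilon>. \<epsilon> \<sqsubset> \<beta>)"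
    and no: "\<And>\<epsilon>. \<epsilon> \<in> V \<Longrightarrow> \<not> hit p c A \<tau> \<rho> \<epsilon> (f \<epsilon>)" by blast+
  have nlt: "\<not> set_lt K (f \<epsilon>) (f \<epsilon>)" if "\<epsilon> \<in> V" for \<epsilon>
    using f[OF that] family_ne[OF A, of "f \<epsilon>"] lt_irrefl unfolding set_lt_def by blast
  obtain Z where Z: "Z \<subseteq> V" "good_family K \<sigma> (f ` Z)"
    "\<And>\<epsilon> \<epsilon>'. \<epsilon> \<in> Z \<Longrightarrow> \<epsilon>' \<in> Z \<Longrightarrow> set_lt K (f \<epsilon>) (f \<epsilon>') \<Longrightarrow> \<forall>\<alpha>\<in>f \<epsilon>. \<rho> \<sqsubset> \<alpha> \<and> \<alpha> \<sqsubset> \<epsilon>'"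
    using interleave[where fa = f and fb = f, OF A A \<sigma>(2) \<rho> f f nlt] by auto
  obtain \<epsilon> \<epsilon>' where e: "\<epsilon> \<in> Z" "\<epsilon>' \<in> Z" "set_lt K (f \<epsilon>) (f \<epsilon>')"
    "\<forall>\<alpha>\<in>f \<epsilon>. \<forall>\<beta>\<in>f \<epsilon>'. c \<alpha> \<beta> = \<tau> (p \<alpha> \<beta>)"
    using c[unfolded pr1_def, rule_format, OF conjI[OF \<sigma>] Z(2) \<tau>] by blast
  have "hit p c A \<tau> \<rho> \<epsilon>' (f \<epsilon>')"
    unfolding hit_def using f e(1) Z(1) Z(3)[OF e(1,2,3)] e(4) by blast
  then show False using no e(2) Z(1) by blast
qed

lemma pr1_circ_reflects:
  fixes \<sigma> :: "'c rel"
  assumes c: "pr1_circ K L chi M p c" and \<sigma>: "Well_order \<sigma>" "\<sigma> <o chi"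
    and A: "good_family K \<sigma> A" and B: "good_family K \<sigma> B"
  shows "reflects M p c A B"
proof (rule ccontr)
  assume "\<not> reflects M p c A B"
  from not_reflects[OF this] obtain \<tau> \<rho> fb where \<tau>: "\<tau> ` M \<subseteq> L" and \<rho>: "\<rho> \<in> V"
    and "\<forall>\<epsilon>\<in>V. (fb \<epsilon> \<in> B \<and> (\<forall>\<beta>\<in>fb \<epsilon>. \<epsilon> \<sqsubset> \<beta>)) \<and> \<not> hit p c A \<tau> \<rho> \<epsilon> (fb \<epsilon>)"
    by (elim exE conjE)
  then have fb: "\<And>\<epsilon>. \<epsilon> \<in> V \<Longrightarrow> fb \<epsilon> \<in> B \<and> (\<forall>\<beta>\<in>fb \<epsilon>. \<epsilon> \<sqsubset> \<beta>)"
    and no: "\<And>\<epsilon>. \<epsilon> \<in> V \<Longrightarrow> \<not> hit p c A \<tau> \<rho> \<epsilon> (fb \<epsilon>)" by blast+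
  have "\<forall>\<epsilon>\<in>V. \<exists>a. a \<in> A \<and> (\<forall>\<alpha>\<in>a. \<epsilon> \<sqsubset> \<alpha>) \<and> \<not> set_lt K a (fb \<epsilon>)"
  proof
    fix \<epsilon> assume \<epsilon>: "\<epsilon> \<in> V"
    then obtain u where u: "u \<in> V" "\<forall>\<beta>\<in>fb \<epsilon>. \<beta> \<sqsubset> u" using family_bounded[OF \<sigma>(2) B] fb by blast
    obtain \<beta> where \<beta>: "\<beta> \<in> fb \<epsilon>" using fb[OF \<epsilon>] family_ne[OF B] by blast
    \<comment> \<open>The partner from \<open>A\<close> is taken beyond all of
      \<open>fb \<epsilon>\<close>, so that two sets with the same index are never in the order
      \<open>set_lt\<close>, as \<open>interleave\<close> demands.\<close>
    obtain a where a: "a \<in> A" "\<forall>\<alpha>\<in>a. u \<sqsubset> \<alpha>" using family_above[OF A u(1)] by blast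
    obtain \<alpha> where \<alpha>: "\<alpha> \<in> a" using family_ne[OF A a(1)] by blast
    have "\<epsilon> \<sqsubset> u" using fb[OF \<epsilon>] u(2) \<beta> lt_le_trans lt_le by blast
    then have "\<forall>\<alpha>\<in>a. \<epsilon> \<sqsubset> \<alpha>" using a(2) lt_le_trans lt_le by blast
    moreover have "\<beta> \<sqsubset> \<alpha>" using u(2) \<beta> a(2) \<alpha> lt_le_trans lt_le by blast
    then have "\<not> set_lt K a (fb \<epsilon>)" using \<alpha> \<beta> lt_le not_lt_le unfolding set_lt_def by blast
    ultimately show "\<exists>a. a \<in> A \<and> (\<forall>\<alpha>\<in>a. \<epsilon> \<sqsubset> \<alpha>) \<and> \<not> set_lt K a (fb \<epsilon>)" using a(1) by blast
  qed
  from bchoice[OF this] obtain fa where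
    "\<forall>\<epsilon>\<in>V. fa \<epsilon> \<in> A \<and> (\<forall>\<alpha>\<in>fa \<epsilon>. \<epsilon> \<sqsubset> \<alpha>) \<and> \<not> set_lt K (fa \<epsilon>) (fb \<epsilon>)" ..
  then have fa: "\<And>\<epsilon>. \<epsilon> \<in> V \<Longrightarrow> fa \<epsilon> \<in> A \<and> (\<forall>\<alpha>\<in>fa \<epsilon>. \<epsilon> \<sqsubset> \<alpha>)"
    and nlt: "\<And>\<epsilon>. \<epsilon> \<in> V \<Longrightarrow> \<not> set_lt K (fa \<epsilon>) (fb \<epsilon>)" by blast+
  obtain Z where Z: "Z \<subseteq> V" "good_family K \<sigma> (fa ` Z)" "good_family K \<sigma> (fb ` Z)"
    "\<And>\<epsilon> \<epsilon>'. \<epsilon> \<in> Z \<Longrightarrow> \<epsilon>' \<in> Z \<Longrightarrow> set_lt K (fa \<epsilon>) (fb \<epsilon>') \<Longrightarrow> \<forall>\<alpha>\<in>fa \<epsilon>. \<rho> \<sqsubset> \<alpha> \<and> \<alpha> \<sqsubset> \<epsilon>'"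
    using interleave[where fa = fa and fb = fb, OF A B \<sigma>(2) \<rho> fa fb nlt] by auto
  obtain A' where A': "A' \<subseteq> fa ` Z" "\<forall>\<tau>. \<tau> ` M \<subseteq> L \<longrightarrow> (\<exists>a\<in>A'. \<exists>b\<in>fb ` Z. set_lt K a b \<and>
                (\<forall>\<alpha>\<in>a. \<forall>\<beta>\<in>b. c \<alpha> \<beta> = \<tau> (p \<alpha> \<beta>)))"
    using c[unfolded pr1_circ_def, rule_format, OF conjI[OF \<sigma>] conjI[OF Z(2,3)]]
    by (elim exE conjE) (rule that)
  obtain a b where ab: "a \<in> A'" "b \<in> fb ` Z" "set_lt K a b"
    "\<forall>\<alpha>\<in>a. \<forall>\<beta>\<in>b. c \<alpha> \<beta> = \<tau> (p \<alpha> \<beta>)" using A'(2)[rule_format, OF \<tau>] by blast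
  then obtain \<epsilon> \<epsilon>' where e: "\<epsilon> \<in> Z" "\<epsilon>' \<in> Z" "a = fa \<epsilon>" "b = fb \<epsilon>'" using A'(1) by blast
  have "fa \<epsilon> \<in> A" using fa e(1) Z(1) by blast
  moreover have "\<forall>\<alpha>\<in>fa \<epsilon>. \<rho> \<sqsubset> \<alpha> \<and> \<alpha> \<sqsubset> \<epsilon>'" using Z(4)[OF e(1,2)] ab(3) e(3,4) by blast
  ultimately have "hit p c A \<tau> \<rho> \<epsilon>' (fb \<epsilon>')"
    unfolding hit_def using ab(4) e(3,4) by blast
  then show False using no e(2) Z(1) by blast
qed

section \<open>Realising patterns with the lifted colouring\<close>

text \<open>The codes of \<open>\<eta>\<close> seen from the elements of \<open>b\<close> form a set
  too small to be cofinal in \<open>lam\<close>, so one index bounds them. It is enlarged to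
  dominate the size of \<open>b\<close> as well, which keeps a union over \<open>b\<close>
  small.\<close>

lemma common_index:
  assumes "\<sigma> <o chi" "|b| \<le>o \<sigma>" "\<And>\<beta>. \<beta> \<in> b \<Longrightarrow> \<eta> \<sqsubset> \<beta>"
  obtains i0 where "i0 \<in> L" "\<And>i. (i0, i) \<in> lam \<Longrightarrow> |b| \<le>o |underS lam i|"
    "\<And>i \<beta>. (i0, i) \<in> lam \<Longrightarrow> \<beta> \<in> b \<Longrightarrow> (enum \<beta> \<eta>, i) \<in> lam"
proof -
  let ?X = "(\<lambda>\<beta>. enum \<beta> \<eta>) ` b"
  have X: "?X \<subseteq> L" using assms(3) enum(2) in_underS lt_V(2) by blast
  have "|?X| \<le>o \<sigma>" using card_of_image assms(2) ordLeq_transitive by blast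
  then obtain i1 where i1: "i1 \<in> L" "\<forall>x\<in>?X. (x, i1) \<in> lam"
    using not_cofinal_bound[OF X small_not_cofinal[OF assms(1) _ X]] by blast
  obtain i2 where i2: "i2 \<in> L" "|b| \<le>o |underS lam i2|"
    using card_below_underS[OF small_less_lam[OF assms(1,2)]] by blast
  obtain i0 where i0: "i0 \<in> L" "(i1, i0) \<in> lam" "(i2, i0) \<in> lam" using lam_max i1(1) i2(1) by blast
  show thesis
  proof (rule that[OF i0(1)])
    fix i assume i: "(i0, i) \<in> lam"
    then have "(i2, i) \<in> lam" using i0(3) lam_trans by blast
    from ordLeq_transitive[OF i2(2) underS_lam_mono[OF this]] show "|b| \<le>o |underS lam i|" .
    fix \<beta> assume "\<beta> \<in> b"
    then have "(enum \<beta> \<eta>, i1) \<in> lam" using i1(2) by blast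
    then show "(enum \<beta> \<eta>, i) \<in> lam" using i i0(2) lam_trans by blast
  qed
qed

lemma lift_hits:
  assumes F: "\<And>G. (\<And>x. x \<in> V \<Longrightarrow> G x \<in> V) \<Longrightarrow> guesses F G"
    and \<sigma>: "\<sigma> <o chi" and A: "good_family K \<sigma> A" and B: "good_family K \<sigma> B"
    and M: "|M| \<le>o lam" and p: "colouring K M p"
    and refl: "reflects M p c A B" and \<tau>: "\<tau> ` M \<subseteq> V"
  shows "\<exists>a\<in>A. \<exists>b\<in>B. set_lt K a b \<and> (\<forall>\<alpha>\<in>a. \<forall>\<beta>\<in>b. lift F c \<alpha> \<beta> = \<tau> (p \<alpha> \<beta>))"
proof -
  have "|\<tau> ` M| \<le>o lam" using M card_of_image ordLeq_transitive by blast
  then obtain \<gamma> where \<gamma>: "\<gamma> \<in> V" "\<forall>y\<in>\<tau> ` M. y \<sqsubset> \<gamma>" using bounded_of_card_le[OF \<tau>] by blast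
  \<comment> \<open>Membership in \<open>cl G\<close> yields only weak inequalities; passing through
    \<open>\<gamma>'\<close> gives \<open>\<gamma> \<sqsubset> \<delta>\<close>, as needed to code
    \<open>\<gamma>\<close> below \<open>\<delta>\<close>.\<close>
  obtain \<gamma>' where \<gamma>': "\<gamma> \<sqsubset> \<gamma>'" using V_nomax[OF \<gamma>(1)] by blast
  \<comment> \<open>The pair \<open>s\<close> will be \<open>(i, enum \<delta> \<gamma>)\<close>,
    unknown until the club has been guessed. All pairs in \<open>L \<times> L\<close> are therefore
    prepared now; there are few enough for \<open>G\<close> to dominate the bounds \<open>e\<close>
    for all of them.\<close>
  define T where "T s m = code (fst s, snd s, enum \<gamma> (\<tau> m))" for s m
  have k: "enum \<gamma> (\<tau> m) \<in> L" if "m \<in> M" for m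
    using that \<gamma>(2) enum(2)[OF \<gamma>(1)] in_underS by blast
  have T: "T s ` M \<subseteq> L" if "s \<in> L \<times> L" for s
    using that k code(2) unfolding T_def by (auto simp: image_subset_iff)
  let ?R = "\<lambda>s \<rho> \<epsilon>. \<epsilon> \<in> V \<and> (\<forall>b\<in>B. (\<forall>\<beta>\<in>b. \<epsilon> \<sqsubset> \<beta>) \<longrightarrow> hit p c A (T s) \<rho> \<epsilon> b)"
  have "\<forall>x\<in>(L \<times> L) \<times> V. \<exists>\<epsilon>. ?R (fst x) (snd x) \<epsilon>"
  proof
    fix x assume "x \<in> (L \<times> L) \<times> V"
    then have x: "fst x \<in> L \<times> L" "snd x \<in> V" by auto
    then have "T (fst x) ` M \<subseteq> L" by (intro T)
    then show "\<exists>\<epsilon>. ?R (fst x) (snd x) \<epsilon>" using refl x(2) unfolding reflects_def by blast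
  qed
  from bchoice[OF this] obtain e where "\<forall>x\<in>(L \<times> L) \<times> V. ?R (fst x) (snd x) (e x)" ..
  then have e: "?R s \<rho> (e (s, \<rho>))" if "s \<in> L \<times> L" "\<rho> \<in> V" for s \<rho>
    using bspec[of "(L \<times> L) \<times> V" _ "(s, \<rho>)"] that by auto
  have "\<forall>\<rho>\<in>V. \<exists>g. g \<in> V \<and> \<gamma>' \<sqsubseteq> g \<and> (\<forall>s\<in>L \<times> L. e (s, \<rho>) \<sqsubseteq> g)"
  proof
    fix \<rho> assume \<rho>: "\<rho> \<in> V"
    let ?E = "(\<lambda>s. e (s, \<rho>)) ` (L \<times> L)"
    have "|L \<times> L| \<le>o |L|"
      using inf_lam by (intro card_of_Times_ordLeq_infinite_Field)
        (simp_all add: Field_card_of card_of_card_order_on card_of_mono1)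
    then have "|?E| \<le>o lam"
      using card_of_image ordLeq_transitive card_L ordLeq_ordIso_trans by meson
    moreover have "?E \<subseteq> V" using e \<rho> by blast
    ultimately obtain u where u: "u \<in> V" "\<forall>y\<in>?E. y \<sqsubset> u" using bounded_of_card_le by blast
    have j: "\<gamma>' \<sqsubseteq> join \<gamma>' u" "u \<sqsubseteq> join \<gamma>' u" "join \<gamma>' u \<in> V" using join[OF lt_V(2)[OF \<gamma>'] u(1)] by blast+
    then have "\<forall>s\<in>L \<times> L. e (s, \<rho>) \<sqsubseteq> join \<gamma>' u" using u(2) lt_le_trans lt_le by blast
    then show "\<exists>g. g \<in> V \<and> \<gamma>' \<sqsubseteq> g \<and> (\<forall>s\<in>L \<times> L. e (s, \<rho>) \<sqsubseteq> g)" using j by blast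
  qed
  from bchoice[OF this] obtain G where
    G: "\<forall>\<rho>\<in>V. G \<rho> \<in> V \<and> \<gamma>' \<sqsubseteq> G \<rho> \<and> (\<forall>s\<in>L \<times> L. e (s, \<rho>) \<sqsubseteq> G \<rho>)" ..
  then have "guesses F G" using F by blast
  then obtain \<eta> where \<eta>: "\<eta> \<in> V" "\<And>i0. i0 \<in> L \<Longrightarrow> \<exists>i. (i0, i) \<in> lam \<and> infinite (underS lam i) \<and>
     (\<exists>\<delta>\<in>trace F \<eta> i. \<delta> \<in> cl G \<and> bigcof i \<delta>)" unfolding guesses_def by blast
  obtain b where b: "b \<in> B" "\<And>\<beta>. \<beta> \<in> b \<Longrightarrow> \<eta> \<sqsubset> \<beta>" using family_above[OF B \<eta>(1)] by blast
  obtain i0 where i0: "i0 \<in> L" "\<And>i. (i0, i) \<in> lam \<Longrightarrow> |b| \<le>o |underS lam i|"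
    "\<And>i \<beta>. (i0, i) \<in> lam \<Longrightarrow> \<beta> \<in> b \<Longrightarrow> (enum \<beta> \<eta>, i) \<in> lam"
    using common_index[OF \<sigma> family_card[OF B b(1)] b(2)] by blast
  obtain i \<delta> where i: "(i0, i) \<in> lam" "infinite (underS lam i)" and
    \<delta>: "\<delta> \<in> trace F \<eta> i" "\<delta> \<in> cl G" "bigcof i \<delta>" using \<eta>(2)[OF i0(1)] by blast
  have iL: "i \<in> L" using i(1) by (rule FieldI2)
  have \<delta>V: "\<delta> \<in> V" using \<delta>(2) by (rule cl_V)
  have \<delta>\<beta>: "\<delta> \<sqsubset> \<beta>" if "\<beta> \<in> b" for \<beta> using trace_cl[OF \<eta>(1) \<delta>(1)] b(2)[OF that] le_lt_trans by blast
  have reach: "\<delta> \<in> reach F \<beta> i" if "\<beta> \<in> b" for \<beta>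
    using b(2)[OF that] i0(3)[OF i(1) that] \<delta>(1) unfolding reach_def by blast
  let ?Y = "(\<Union>\<beta>\<in>b. reach F \<beta> i) \<inter> underS K \<delta>"
  have "|\<Union>\<beta>\<in>b. reach F \<beta> i| \<le>o |underS lam i|"
  proof (rule card_of_UNION_ordLeq_infinite[OF i(2) i0(2)[OF i(1)]], rule ballI)
    fix \<beta> assume "\<beta> \<in> b"
    then have "\<beta> \<in> V" using b(2) lt_V(2) by blast
    then show "|reach F \<beta> i| \<le>o |underS lam i|" by (rule reach_card[OF i(2)])
  qed
  then have "|?Y| \<le>o |underS lam i|" by (rule card_le_subset[rotated]) blast
  \<comment> \<open>The large cofinality of \<open>\<delta>\<close> yields one \<open>\<rho>\<close>
    above all points below \<open>\<delta>\<close> that any \<open>\<beta>\<close> in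
    \<open>b\<close> can reach. An \<open>\<alpha>\<close> between \<open>\<rho>\<close> and
    \<open>\<delta>\<close> then sees \<open>\<delta>\<close> as the next reachable point.\<close>
  then obtain \<rho> where \<rho>: "\<rho> \<sqsubset> \<delta>" "\<forall>y\<in>?Y. y \<sqsubseteq> \<rho>" using \<delta>(3) unfolding bigcof_def by blast
  have \<rho>V: "\<rho> \<in> V" using \<rho>(1) by (rule lt_V(1))
  have G\<delta>: "G \<rho> \<sqsubseteq> \<delta>" using \<delta>(2) \<rho>(1) unfolding cl_def by blast
  have "\<gamma> \<sqsubset> \<delta>" using \<gamma>' G \<rho>V G\<delta> lt_le_trans le_trans by blast
  then have j: "enum \<delta> \<gamma> \<in> L" using enum(2)[OF \<delta>V] in_underS by blast
  let ?s = "(i, enum \<delta> \<gamma>)"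
  have s: "?s \<in> L \<times> L" using iL j by blast
  then have e\<delta>: "e (?s, \<rho>) \<sqsubseteq> \<delta>" using G \<rho>V G\<delta> le_trans by blast
  then have "\<forall>\<beta>\<in>b. e (?s, \<rho>) \<sqsubset> \<beta>" using \<delta>\<beta> le_lt_trans by blast
  then have "hit p c A (T ?s) \<rho> (e (?s, \<rho>)) b" using e[OF s \<rho>V] b(1) by simp
  then obtain a where a: "a \<in> A" "\<And>\<alpha>. \<alpha> \<in> a \<Longrightarrow> \<rho> \<sqsubset> \<alpha> \<and> \<alpha> \<sqsubset> e (?s, \<rho>)"
    "\<And>\<alpha> \<beta>. \<alpha> \<in> a \<Longrightarrow> \<beta> \<in> b \<Longrightarrow> c \<alpha> \<beta> = T ?s (p \<alpha> \<beta>)"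
    unfolding hit_def by blast
  have \<alpha>\<delta>: "\<alpha> \<sqsubset> \<delta>" if "\<alpha> \<in> a" for \<alpha> using a(2)[OF that] e\<delta> lt_le_trans by blast
  have "\<alpha> \<sqsubset> \<beta> \<and> lift F c \<alpha> \<beta> = \<tau> (p \<alpha> \<beta>)" if ab: "\<alpha> \<in> a" "\<beta> \<in> b" for \<alpha> \<beta>
  proof -
    have lt: "\<alpha> \<sqsubset> \<beta>" using \<alpha>\<delta>[OF ab(1)] \<delta>\<beta>[OF ab(2)] lt_le_trans lt_le by blast
    then have m: "p \<alpha> \<beta> \<in> M" using p lt_V[OF lt] unfolding colouring_def by blast
    have dec: "decode (c \<alpha> \<beta>) = (i, enum \<delta> \<gamma>, enum \<gamma> (\<tau> (p \<alpha> \<beta>)))"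
      using a(3)[OF ab] decode_code[OF iL j k[OF m]] by (simp add: T_def)
    have least: "\<delta> \<sqsubseteq> x" if x: "x \<in> reach F \<beta> i" "\<alpha> \<sqsubset> x" for x
    proof (rule ccontr)
      assume "\<not> \<delta> \<sqsubseteq> x"
      then have "x \<sqsubset> \<delta>" using le_or_lt[OF \<delta>V lt_V(2)[OF x(2)]] by blast
      then have "x \<in> ?Y" using x(1) ab(2) in_underS by blast
      then have "x \<sqsubseteq> \<rho>" using \<rho>(2) by blast
      then show False using a(2)[OF ab(1)] x(2) lt_le_trans lt_le not_lt_le by blast
    qed
    have "(THE \<delta>. \<delta> \<in> reach F \<beta> i \<and> \<alpha> \<sqsubset> \<delta> \<and> (\<forall>x\<in>reach F \<beta> i. \<alpha> \<sqsubset> x \<longrightarrow> \<delta> \<sqsubseteq> x)) = \<delta>"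
    proof (rule the_equality)
      show "\<delta> \<in> reach F \<beta> i \<and> \<alpha> \<sqsubset> \<delta> \<and> (\<forall>x\<in>reach F \<beta> i. \<alpha> \<sqsubset> x \<longrightarrow> \<delta> \<sqsubseteq> x)"
        using reach[OF ab(2)] \<alpha>\<delta>[OF ab(1)] least by blast
      fix z assume "z \<in> reach F \<beta> i \<and> \<alpha> \<sqsubset> z \<and> (\<forall>x\<in>reach F \<beta> i. \<alpha> \<sqsubset> x \<longrightarrow> z \<sqsubseteq> x)"
      then show "z = \<delta>" using reach[OF ab(2)] \<alpha>\<delta>[OF ab(1)] least le_antisym by blast
    qed
    moreover have "\<tau> (p \<alpha> \<beta>) \<sqsubset> \<gamma>" using \<gamma>(2) m by blast
    ultimately have "lift F c \<alpha> \<beta> = \<tau> (p \<alpha> \<beta>)"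
      unfolding lift_def dec using unenum[OF \<open>\<gamma> \<sqsubset> \<delta>\<close>] unenum[of "\<tau> (p \<alpha> \<beta>)" \<gamma>] lt_V(1)[of "\<tau> (p \<alpha> \<beta>)" \<gamma>]
      by (simp add: Let_def)
    then show ?thesis using lt by blast
  qed
  then have "set_lt K a b" "\<forall>\<alpha>\<in>a. \<forall>\<beta>\<in>b. lift F c \<alpha> \<beta> = \<tau> (p \<alpha> \<beta>)"
    unfolding set_lt_def by blast+
  with a(1) b(1) show ?thesis by blast
qed

end

section \<open>Transfer of both partition relations to the successor\<close>

theorem theorem3p6:
  fixes lam :: "'a rel" and chi :: "'c rel"
  assumes "singular_uncountable_cf lam"
    and "Card_order chi"
    and "le_cf chi lam"
    and "colouring (cardSuc lam) (Field lam) c"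
  shows "\<exists>c' :: 'a set \<Rightarrow> 'a set \<Rightarrow> 'a set.
           colouring (cardSuc lam) (Field (cardSuc lam)) c' \<and>
           (\<forall>(M :: 'a set) (p :: 'a set \<Rightarrow> 'a set \<Rightarrow> 'a).
              card_segment lam M \<and> colouring (cardSuc lam) M p \<longrightarrow>
              (pr1 (cardSuc lam) (Field lam) chi M p c \<longrightarrow>
                 pr1 (cardSuc lam) (Field (cardSuc lam)) chi M p c') \<and>
              (pr1_circ (cardSuc lam) (Field lam) chi M p c \<longrightarrow>
                 pr1_circ (cardSuc lam) (Field (cardSuc lam)) chi M p c'))"
proof -
  interpret below_cofinality lam chi
  proof
    show "Card_order lam" "infinite (Field lam)"
      using assms(1) unfolding singular_uncountable_cf_def by blast+
    show "natLeq <o |A|" if "A \<subseteq> Field lam" "cofinal A lam" for A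
      using that assms(1) unfolding singular_uncountable_cf_def by blast
    show "chi \<le>o |A|" if "A \<subseteq> Field lam" "cofinal A lam" for A
      using that assms(3) unfolding le_cf_def by blast
  qed
  obtain F where F: "\<And>G. (\<And>x. x \<in> V \<Longrightarrow> G x \<in> V) \<Longrightarrow> guesses F G" using guessing by blast
  have M: "|M| \<le>o lam" if "card_segment lam M" for M
  proof -
    have "M \<subseteq> L" using that underS_Field unfolding card_segment_def by auto
    then show ?thesis using card_le_subset card_L ordIso_imp_ordLeq by blast
  qed
  have "pr1 K V chi M p (lift F c)"
    if "card_segment lam M" "colouring K M p" "pr1 K L chi M p c" for M p
    unfolding pr1_def
  proof (intro allI impI, elim conjE)
    fix \<sigma> :: "'c rel" and A and \<tau> :: "'a \<Rightarrow> 'a set"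
    assume \<sigma>: "Well_order \<sigma>" "\<sigma> <o chi" and A: "good_family K \<sigma> A" and \<tau>: "\<tau> ` M \<subseteq> V"
    show "\<exists>a\<in>A. \<exists>b\<in>A. set_lt K a b \<and> (\<forall>\<alpha>\<in>a. \<forall>\<beta>\<in>b. lift F c \<alpha> \<beta> = \<tau> (p \<alpha> \<beta>))"
      using lift_hits[OF F \<sigma>(2) A A M[OF that(1)] that(2) pr1_reflects[OF that(3) \<sigma> A] \<tau>] .
  qed
  moreover have "pr1_circ K V chi M p (lift F c)"
    if "card_segment lam M" "colouring K M p" "pr1_circ K L chi M p c" for M p
    unfolding pr1_circ_def
  proof (intro allI impI, elim conjE)
    fix \<sigma> :: "'c rel" and A B
    assume \<sigma>: "Well_order \<sigma>" "\<sigma> <o chi" and A: "good_family K \<sigma> A" and B: "good_family K \<sigma> B"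
    \<comment> \<open>The whole family \<open>A\<close> can serve as \<open>A'\<close>, because
      \<open>lift_hits\<close> finds the required pair in \<open>A\<close> and \<open>B\<close> for
      each \<open>\<tau>\<close> separately.\<close>
    have "\<forall>\<tau>. \<tau> ` M \<subseteq> V \<longrightarrow>
        (\<exists>a\<in>A. \<exists>b\<in>B. set_lt K a b \<and> (\<forall>\<alpha>\<in>a. \<forall>\<beta>\<in>b. lift F c \<alpha> \<beta> = \<tau> (p \<alpha> \<beta>)))"
      using lift_hits[OF F \<sigma>(2) A B M[OF that(1)] that(2) pr1_circ_reflects[OF that(3) \<sigma> A B]] by blast
    moreover have "|A| =o K" using A unfolding good_family_def by blast
    ultimately show "\<exists>A'\<subseteq>A. |A'| =o K \<and> (\<forall>\<tau>. \<tau> ` M \<subseteq> V \<longrightarrow>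
        (\<exists>a\<in>A'. \<exists>b\<in>B. set_lt K a b \<and> (\<forall>\<alpha>\<in>a. \<forall>\<beta>\<in>b. lift F c \<alpha> \<beta> = \<tau> (p \<alpha> \<beta>))))" by blast
  qed
  ultimately show ?thesis using colouring_lift[of F c] by blast
qed

end
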